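(* Let $0<M_1\le M_0<\infty$ and let $k$ be a natural number. If $$\frac n2\ \ge\ \big[\min\{(M_0-M_1)^2,1\}\log p\big]\vee k,$$ then $$\inf_{(\pi,f)\in\Pi^*}\ \sup_{\Sigma_0\in\mathcal{B}_{p,k}}E_{\Sigma_0}\Big\{E^{\pi}\big(\|f(\Sigma)-\Sigma_0\|^2\ \big|\ \mathbb{X}_n\big)\Big\}\ \ge\ C\,\frac{k+\log p}{n},$$ where $C$ is a constant that depends on $M_0$ and $M_1$.
   Context: Notation. $a\vee b=\max\{a,b\}$; $\mathcal{C}_p$ is the set of all $p\times p$ positive definite matrices; $[p]=\{1,\dots,p\}$; $\lambda_{\min},\lambda_{\max}$ are the minimum and maximum eigenvalues; $\|A\|=\{\lambda_{\max}(AA^T)\}^{1/2}$ is the spectral norm of a symmetric matrix $A$. The class of $k$-banded covariance matrices is $$\mathcal{B}_{p,k}=\mathcal{B}_{p,k}(M_0,M_1)=\{\Sigma=(\sigma_{ij})\in\mathcal{C}_p:\ \sigma_{ij}=0\text{ if }|i-j|>k,\ \forall i,j\in[p],\ \lambda_{\max}(\Sigma)\le M_0,\ \lambda_{\min}(\Sigma)\ge M_1\}.$$ Model. $X_1,\dots,X_n$ are independent and identically distributed from the $p$-dimensional normal distribution $N_p(0,\Sigma)$ with mean zero and covariance matrix $\Sigma$, and $\mathbb{X}_n=(X_1,\dots,X_n)^T$. $\Sigma_0$ denotes the true value of $\Sigma$, and $E_{\Sigma_0}$ denotes expectation with respect to random samples $X_1,\dots,X_n$ from $N_p(0,\Sigma_0)$.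 Post-processed posterior procedures. A post-processed posterior procedure is a pair $(\pi,f)$ of an initial prior $\pi$ for $\Sigma$ and a post-processing function $f$, which is applied to $\Sigma$ drawn from the initial posterior (the posterior under $\pi$); the resulting distribution of $f(\Sigma)$ given $\mathbb{X}_n$ is the post-processed posterior. $\Pi^*=\{(\pi,f):\pi\in\Pi,\ f\in\mathcal{F}\}$ is the space of all possible post-processing procedures, where $\Pi$ is the space of all priors on $\mathcal{C}_p$ and $\mathcal{F}$ is the space of all possible post-processing functions (for example, functions $f:\mathcal{C}_p\to\mathcal{B}_{p,k}$; a conventional Bayesian procedure, with a prior supported on $\mathcal{B}_{p,k}$ and the identity post-processing function, is also regarded as such a procedure). $E^{\pi}(\cdot\mid\mathbb{X}_n)$ denotes expectation over $\Sigma$ drawn from the posterior distribution of $\Sigma$ given $\mathbb{X}_n$ under the prior $\pi$ and the $N_p(0,\Sigma)$ likelihood.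
   Formalization: The formal theorem adds k ≤ p (for p = 1, k = n/2, n → ∞ the claim fails) and asserts C > 0 only when M_1 < M_0 (for M_1 = M_0 the class is the single matrix M_0·I and the risk can be 0); for M_1 = M_0 only C ≥ 0 is claimed. *)

theory Defs
  imports "HOL-Probability.Probability" "Jordan_Normal_Form.Spectral_Radius"
    "Jordan_Normal_Form.Gauss_Jordan_Elimination"
begin

text \<open>
  The dimension \<open>p\<close> is an explicit natural number, because the constant of the theorem has to be
  uniform in \<open>p\<close>. Rows, columns and coordinates are indexed by \<open>{..<p}\<close>.
\<close>

definition pos_def_mats :: "nat \<Rightarrow> real mat set" where
  "pos_def_mats p = {A \<in> carrier_mat p p. transpose_mat A = A \<and>
     (\<forall>v \<in> carrier_vec p. v \<noteq> 0\<^sub>v p \<longrightarrow> scalar_prod v (A *\<^sub>v v) > 0)}"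

text \<open>
  These two are meant for real symmetric matrices of dimension at least one, whose spectrum is
  finite and nonempty.
\<close>

definition lambda_max :: "real mat \<Rightarrow> real" where
  "lambda_max A = Max (spectrum A)"

definition lambda_min :: "real mat \<Rightarrow> real" where
  "lambda_min A = Min (spectrum A)"

definition spectral_norm :: "real mat \<Rightarrow> real" where
  "spectral_norm A = sqrt (lambda_max (A * transpose_mat A))"

definition banded_cov :: "nat \<Rightarrow> nat \<Rightarrow> real \<Rightarrow> real \<Rightarrow> real mat set" where
  "banded_cov p k M0 M1 = {S \<in> pos_def_mats p.
     (\<forall>i<p. \<forall>j<p. \<bar>int i - int j\<bar> > int k \<longrightarrow> S $$ (i, j) = 0) \<and>
     lambda_max S \<le> M0 \<and> lambda_min S \<ge> M1}"

text \<open>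
  The Borel \<open>\<sigma>\<close>-algebra on the \<open>p \<times> p\<close> matrices, pulled back along the identification of a matrix
  with its family of entries (the type of matrices carries no topology), and its trace on the
  positive definite matrices. Only the \<open>\<sigma>\<close>-algebras of these measures are used.
\<close>

definition mat_borel :: "nat \<Rightarrow> real mat measure" where
  "mat_borel p = vimage_algebra (carrier_mat p p)
     (\<lambda>A. \<lambda>ij \<in> {..<p} \<times> {..<p}. A $$ ij) (PiM ({..<p} \<times> {..<p}) (\<lambda>_. borel))"

definition pos_def_borel :: "nat \<Rightarrow> real mat measure" where
  "pos_def_borel p = restrict_space (mat_borel p) (pos_def_mats p)"

definition mvn_density :: "nat \<Rightarrow> real mat \<Rightarrow> (nat \<Rightarrow> real) \<Rightarrow> real" where
  "mvn_density p S x =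
     exp (- scalar_prod (vec p x) (the (mat_inverse S) *\<^sub>v vec p x) / 2) /
     sqrt ((2 * pi) ^ p * Determinant.det S)"

definition mvn :: "nat \<Rightarrow> real mat \<Rightarrow> (nat \<Rightarrow> real) measure" where
  "mvn p S = density (PiM {..<p} (\<lambda>_. lborel)) (\<lambda>x. ennreal (mvn_density p S x))"

definition sample_dist :: "nat \<Rightarrow> nat \<Rightarrow> real mat \<Rightarrow> (nat \<Rightarrow> nat \<Rightarrow> real) measure" where
  "sample_dist n p S = PiM {..<n} (\<lambda>_. mvn p S)"

definition likelihood :: "nat \<Rightarrow> nat \<Rightarrow> (nat \<Rightarrow> nat \<Rightarrow> real) \<Rightarrow> real mat \<Rightarrow> real" where
  "likelihood n p X S = (\<Prod>i<n. mvn_density p S (X i))"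

text \<open>
  Bayes' formula. The normalising constant is positive, and it is finite for Lebesgue-almost every
  sample \<open>X\<close>; on the exceptional null set the value below is the null measure.
\<close>

definition posterior ::
  "nat \<Rightarrow> nat \<Rightarrow> real mat measure \<Rightarrow> (nat \<Rightarrow> nat \<Rightarrow> real) \<Rightarrow> real mat measure" where
  "posterior n p \<pi> X = density \<pi>
     (\<lambda>S. ennreal (likelihood n p X S) / (\<integral>\<^sup>+ T. ennreal (likelihood n p X T) \<partial>\<pi>))"

definition priors :: "nat \<Rightarrow> real mat measure set" where
  "priors p = {\<pi>. prob_space \<pi> \<and> sets \<pi> = sets (pos_def_borel p)}"

text \<open>
  No structural restriction is put on the values of a post-processing function: measurable maps into
  the banded covariance matrices, and the identity, are included.
\<close>

definition post_functions :: "nat \<Rightarrow> (real mat \<Rightarrow> real mat) set" where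
  "post_functions p = measurable (pos_def_borel p) (mat_borel p)"

definition pp_procedures :: "nat \<Rightarrow> (real mat measure \<times> (real mat \<Rightarrow> real mat)) set" where
  "pp_procedures p = priors p \<times> post_functions p"

definition pp_risk ::
  "nat \<Rightarrow> nat \<Rightarrow> real mat measure \<Rightarrow> (real mat \<Rightarrow> real mat) \<Rightarrow> real mat \<Rightarrow> ennreal" where
  "pp_risk n p \<pi> f S0 =
     (\<integral>\<^sup>+ X. (\<integral>\<^sup>+ S. ennreal ((spectral_norm (f S - S0))\<^sup>2) \<partial>posterior n p \<pi> X)
        \<partial>sample_dist n p S0)"

end

theory Submission
  imports Defs
begin

text \<open>
  A post-processed posterior is nothing but a randomised estimator: given the sample, it draws
  \<open>\<Sigma>\<close> from a probability distribution and reports \<open>f(\<Sigma>)\<close>. Its risk is therefore bounded below by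
  the classical arguments that replace the supremum over the parameter space by an average over
  finitely many hypotheses (\<open>bayes_risk_ge\<close>). The one analytic point is that the posterior really
  is a probability distribution for almost every sample. By Tonelli this follows from the fact
  that the Gaussian density integrates to one for every positive definite covariance matrix,
  which in turn is an induction on the dimension with Schur complements. Once this is known, a
  pointwise bound \<open>m(X) \<le> \<Sum>\<^sub>t w\<^sub>t p\<^sub>t(X) \<parallel>A - \<Sigma>\<^sub>t\<parallel>\<^sup>2\<close>, valid for all matrices \<open>A\<close>, bounds the weighted
  risk by \<open>\<integral> m\<close>.

  Two families of hypotheses give the two terms of the rate. Write \<open>a = (M\<^sub>0 + M\<^sub>1) / 2\<close> and
  \<open>e = (M\<^sub>0 - M\<^sub>1) / 2\<close>.

  The term \<open>k / n\<close> (\<open>sup_risk_ge_bandwidth\<close>) comes from Assouad's argument. Take \<open>a\<close> on the diagonal and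
  \<open>\<plusminus>a\<tau>\<close>, with \<open>\<tau>\<close> of order \<open>1 / sqrt n\<close>, in the first row and column at the positions \<open>1, \<dots>, k - 1\<close>,
  with an arbitrary choice of the \<open>k - 1\<close> signs. The squared spectral norm dominates the sum of the
  squares of the first row, so the loss splits into \<open>k - 1\<close> one-dimensional losses, and in each of
  them the two values of a sign cannot be told apart from \<open>n\<close> observations. The perturbation has
  spectral norm of order \<open>a\<tau> sqrt k\<close>, which is at most \<open>e\<close> because \<open>n \<ge> 2k\<close>.

  The term \<open>ln p / n\<close> (\<open>sup_risk_ge_log_dimension\<close>) comes from Le Cam's argument. Compare \<open>a\<close> times the
  identity with the uniform mixture of the \<open>p\<close> diagonal matrices in which one variance is raised to
  \<open>a(1 + \<delta>)\<close>. The second moment of the likelihood ratio is \<open>1 - 1/p + (1 - \<delta>\<^sup>2)\<^bsup>-n/2\<^esup> / p\<close>, which remains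
  at most \<open>2\<close> as long as \<open>\<delta>\<^sup>2\<close> is of order \<open>ln (p + 1) / n\<close>. With \<open>p + 1\<close> in the logarithm the bound stays
  of order \<open>1 / n\<close> when \<open>p = 1\<close>, and this makes up for having \<open>k - 1\<close> rather than \<open>k\<close> in the first
  bound.

  Both families consist of covariance matrices of a linear regression of the first coordinate on
  the others, whose Gaussian density factorises explicitly (\<open>mvn_density_regression_cov\<close>).
  The likelihood ratios are then one-dimensional Gaussian integrals. Overlap of two densities is
  bounded through \<open>min q r \<ge> r - r\<^sup>2 / (4q)\<close> (\<open>affinity_ge_half\<close>), so that only second moments of
  likelihood ratios have to be computed.
\<close>

section \<open>Quadratic forms and the spectrum of symmetric matrices\<close>

text \<open>
  Vectors are represented by functions on the indices, as in the Gaussian densities, so that the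
  product topology and the product measures apply to them directly.
\<close>

definition quad_form :: "nat \<Rightarrow> real mat \<Rightarrow> (nat \<Rightarrow> real) \<Rightarrow> real" where
  "quad_form p S x = (\<Sum>i<p. \<Sum>j<p. S $$ (i, j) * x i * x j)"

lemma mult_mat_vec_entry:
  assumes "S \<in> carrier_mat p p" "i < p"
  shows "vec_index (S *\<^sub>v vec p x) i = (\<Sum>j<p. S $$ (i, j) * x j)"
  using assms by (auto simp: scalar_prod_def lessThan_atLeast0 intro!: sum.cong)

lemma scalar_prod_eq_quad_form:
  assumes "S \<in> carrier_mat p p"
  shows "scalar_prod (vec p x) (S *\<^sub>v vec p x) = quad_form p S x"
proof -
  have "scalar_prod (vec p x) (S *\<^sub>v vec p x) = (\<Sum>i<p. x i * (\<Sum>j<p. S $$ (i, j) * x j))"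
    using assms mult_mat_vec_entry[OF assms]
    by (auto simp: scalar_prod_def lessThan_atLeast0 intro!: sum.cong)
  also have "\<dots> = quad_form p S x"
    by (simp add: quad_form_def sum_distrib_left mult_ac)
  finally show ?thesis .
qed

lemma vec_of_vec_index: "v \<in> carrier_vec p \<Longrightarrow> vec p (vec_index v) = v"
  by auto

lemma vec_eq_zero_iff: "vec p x = 0\<^sub>v p \<longleftrightarrow> (\<forall>i<p. x i = 0)"
  by (auto simp: vec_eq_iff)

lemma pos_def_mats_iff:
  "S \<in> pos_def_mats p \<longleftrightarrow> S \<in> carrier_mat p p \<and> (\<forall>i<p. \<forall>j<p. S $$ (i, j) = S $$ (j, i)) \<and>
     (\<forall>x. (\<exists>i<p. x i \<noteq> 0) \<longrightarrow> quad_form p S x > 0)"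
proof (cases "S \<in> carrier_mat p p")
  case True
  have "transpose_mat S = S \<longleftrightarrow> (\<forall>i<p. \<forall>j<p. S $$ (i, j) = S $$ (j, i))"
    using True by (auto simp: mat_eq_iff)
  moreover have "(\<forall>v \<in> carrier_vec p. v \<noteq> 0\<^sub>v p \<longrightarrow> scalar_prod v (S *\<^sub>v v) > 0) \<longleftrightarrow>
     (\<forall>x. (\<exists>i<p. x i \<noteq> 0) \<longrightarrow> quad_form p S x > 0)" (is "?L \<longleftrightarrow> ?R")
  proof
    assume ?L
    show ?R
    proof (intro allI impI)
      fix x :: "nat \<Rightarrow> real" assume "\<exists>i<p. x i \<noteq> 0"
      then have "vec p x \<noteq> 0\<^sub>v p" by (simp add: vec_eq_zero_iff)
      with \<open>?L\<close> have "scalar_prod (vec p x) (S *\<^sub>v vec p x) > 0" by simp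
      then show "quad_form p S x > 0" using scalar_prod_eq_quad_form[OF True] by simp
    qed
  next
    assume ?R
    show ?L
    proof (intro ballI impI)
      fix v :: "real vec" assume v: "v \<in> carrier_vec p" "v \<noteq> 0\<^sub>v p"
      then have "\<exists>i<p. vec_index v i \<noteq> 0"
        using vec_eq_zero_iff[of p "vec_index v"] vec_of_vec_index[of v p] by simp
      then show "scalar_prod v (S *\<^sub>v v) > 0"
        using \<open>?R\<close> scalar_prod_eq_quad_form[OF True, of "vec_index v"] vec_of_vec_index[OF v(1)] by simp
    qed
  qed
  ultimately show ?thesis using True by (simp add: pos_def_mats_def)
qed (auto simp: pos_def_mats_def)

lemma quad_form_cong: "(\<And>i. i < p \<Longrightarrow> x i = y i) \<Longrightarrow> quad_form p S x = quad_form p S y"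
  by (auto simp: quad_form_def intro!: sum.cong)

lemma quad_form_scale: "quad_form p S (\<lambda>i. c * x i) = c\<^sup>2 * quad_form p S x"
  by (simp add: quad_form_def sum_distrib_left power2_eq_square mult_ac)

lemma quad_form_add:
  assumes "\<And>i j. i < p \<Longrightarrow> j < p \<Longrightarrow> S $$ (i, j) = S $$ (j, i)"
  shows "quad_form p S (\<lambda>i. x i + t * y i) =
    quad_form p S x + 2 * t * (\<Sum>i<p. y i * (\<Sum>j<p. S $$ (i, j) * x j)) + t\<^sup>2 * quad_form p S y"
proof -
  have e: "(\<Sum>i<p. \<Sum>j<p. S $$ (i, j) * x i * y j) = (\<Sum>i<p. \<Sum>j<p. S $$ (i, j) * y i * x j)"
    by (subst sum.swap) (auto simp: assms mult_ac intro!: sum.cong)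
  have "quad_form p S (\<lambda>i. x i + t * y i) = (\<Sum>i<p. \<Sum>j<p. S $$ (i, j) * x i * x j
     + t * (S $$ (i, j) * x i * y j) + t * (S $$ (i, j) * y i * x j) + t\<^sup>2 * (S $$ (i, j) * y i * y j))"
    unfolding quad_form_def by (intro sum.cong refl) (simp add: algebra_simps power2_eq_square)
  also have "\<dots> = quad_form p S x + t * (\<Sum>i<p. \<Sum>j<p. S $$ (i, j) * x i * y j)
     + t * (\<Sum>i<p. \<Sum>j<p. S $$ (i, j) * y i * x j) + t\<^sup>2 * quad_form p S y"
    by (simp add: sum.distrib quad_form_def sum_distrib_left)
  finally show ?thesis unfolding e by (simp add: sum_distrib_left mult_ac)
qed

text \<open>
  Compactness of the unit sphere, obtained from Tychonoff's theorem for a cube in which all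
  coordinates from \<open>p\<close> on are pinned to \<open>0\<close>; the general case follows by homogeneity.
\<close>

lemma rayleigh_maximiser:
  assumes "p \<ge> 1"
  obtains u where "(\<Sum>i<p. (u i)\<^sup>2) = 1" "\<And>x. quad_form p S x \<le> quad_form p S u * (\<Sum>i<p. (x i)\<^sup>2)"
proof -
  define B :: "(nat \<Rightarrow> real) set" where "B = Pi UNIV (\<lambda>i. if i < p then {-1..1} else {0})"
  have "compact B"
    using compactin_PiE[of "\<lambda>_. euclidean :: real topology" UNIV "\<lambda>i. if i < p then {-1..1} else {0}"]
    by (simp add: B_def PiE_UNIV_domain euclidean_product_topology)
  have cont [continuous_intros]: "continuous_on A (\<lambda>x::nat\<Rightarrow>real. x i)" for A i
    by (intro continuous_on_product_coordinates continuous_on_subset[OF _ subset_UNIV])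
  define K where "K = B \<inter> {x. (\<Sum>i<p. (x i)\<^sup>2) = 1}"
  have "closed {x :: nat \<Rightarrow> real. (\<Sum>i<p. (x i)\<^sup>2) = 1}"
    by (intro closed_Collect_eq continuous_intros)
  with \<open>compact B\<close> have "compact K" unfolding K_def by (rule compact_Int_closed)
  have "(\<lambda>i. if i = 0 then 1 else 0) \<in> K"
    using assms by (auto simp: K_def B_def if_distrib[of "\<lambda>x. x\<^sup>2"] sum.delta cong: if_cong)
  then have "K \<noteq> {}" by auto
  have "continuous_on K (quad_form p S)"
    unfolding quad_form_def by (intro continuous_intros)
  from continuous_attains_sup[OF \<open>compact K\<close> \<open>K \<noteq> {}\<close> this]
  obtain u where u: "u \<in> K" and max: "\<And>y. y \<in> K \<Longrightarrow> quad_form p S y \<le> quad_form p S u" by auto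
  have "quad_form p S x \<le> quad_form p S u * (\<Sum>i<p. (x i)\<^sup>2)" for x
  proof (cases "\<forall>i<p. x i = 0")
    case True
    then show ?thesis by (simp add: quad_form_def)
  next
    case False
    define s where "s = (\<Sum>i<p. (x i)\<^sup>2)"
    have "s > 0" using False unfolding s_def
      by (metis (no_types, lifting) finite_lessThan lessThan_iff sum_pos2 zero_le_power2 zero_less_power2)
    define y where "y = (\<lambda>i. if i < p then x i / sqrt s else 0)"
    have "(\<Sum>i<p. (y i)\<^sup>2) = (\<Sum>i<p. (x i)\<^sup>2 / s)"
      unfolding y_def using \<open>s > 0\<close> by (intro sum.cong) (auto simp: power_divide)
    then have y1: "(\<Sum>i<p. (y i)\<^sup>2) = 1"
      using \<open>s > 0\<close> by (simp add: s_def flip: sum_divide_distrib)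
    have "\<bar>y i\<bar> \<le> 1" if "i < p" for i
    proof -
      have "(y i)\<^sup>2 \<le> (\<Sum>i<p. (y i)\<^sup>2)" using that by (intro member_le_sum) auto
      then show ?thesis using y1 by (simp add: abs_square_le_1)
    qed
    then have "-1 \<le> y i \<and> y i \<le> 1" if "i < p" for i
      using that by (metis abs_le_iff minus_le_iff)
    moreover have "y i = 0" if "\<not> i < p" for i using that by (simp add: y_def)
    ultimately have "y \<in> K" using y1 by (auto simp: K_def B_def)
    have "quad_form p S x = quad_form p S (\<lambda>i. sqrt s * y i)"
      using \<open>s > 0\<close> by (intro quad_form_cong) (simp add: y_def)
    also have "\<dots> = s * quad_form p S y"
      using \<open>s > 0\<close> by (simp add: quad_form_scale)
    also have "\<dots> \<le> s * quad_form p S u"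
      using \<open>s > 0\<close> max[OF \<open>y \<in> K\<close>] by simp
    finally show ?thesis by (simp add: s_def mult.commute)
  qed
  moreover have "(\<Sum>i<p. (u i)\<^sup>2) = 1" using u by (simp add: K_def)
  ultimately show thesis using that by blast
qed

lemma eigenvalue_quad_form:
  assumes S: "S \<in> carrier_mat p p" and "eigenvalue S m"
  obtains x where "\<exists>i<p. x i \<noteq> 0" "quad_form p S x = m * (\<Sum>i<p. (x i)\<^sup>2)"
proof -
  from assms obtain v where v: "v \<in> carrier_vec p" "v \<noteq> 0\<^sub>v p" "S *\<^sub>v v = m \<cdot>\<^sub>v v"
    unfolding eigenvalue_def eigenvector_def by auto
  let ?x = "vec_index v"
  have vv: "vec p ?x = v" using v by (simp add: vec_of_vec_index)
  have "quad_form p S ?x = scalar_prod v (m \<cdot>\<^sub>v v)"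
    using scalar_prod_eq_quad_form[OF S, of ?x] vv v by simp
  also have "\<dots> = m * (\<Sum>i<p. (?x i)\<^sup>2)"
    using v by (auto simp: scalar_prod_def lessThan_atLeast0 sum_distrib_left power2_eq_square mult_ac intro!: sum.cong)
  finally show thesis
    using that[of ?x] v(2) vec_eq_zero_iff[of p ?x] vv by auto
qed

text \<open>
  The derivative of the Rayleigh quotient vanishes at a maximiser, which says that the maximiser is
  an eigenvector. In particular a real symmetric matrix has a real eigenvalue, so the maximum and
  the minimum of its spectrum are meaningful.
\<close>

lemma rayleigh_max_eigenvalue:
  assumes p: "p \<ge> 1" and S: "S \<in> carrier_mat p p"
    and sym: "\<And>i j. i < p \<Longrightarrow> j < p \<Longrightarrow> S $$ (i, j) = S $$ (j, i)"
  obtains m where "m \<in> spectrum S" "\<And>x. quad_form p S x \<le> m * (\<Sum>i<p. (x i)\<^sup>2)"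
proof -
  obtain u where u: "(\<Sum>i<p. (u i)\<^sup>2) = 1"
    and max: "\<And>x. quad_form p S x \<le> quad_form p S u * (\<Sum>i<p. (x i)\<^sup>2)"
    using rayleigh_maximiser[OF p, of S] by blast
  define m where "m = quad_form p S u"
  have crit: "(\<Sum>i<p. y i * (\<Sum>j<p. S $$ (i, j) * u j)) = m * (\<Sum>i<p. y i * u i)" for y
  proof -
    define d where "d = (\<Sum>i<p. y i * (\<Sum>j<p. S $$ (i, j) * u j)) - m * (\<Sum>i<p. y i * u i)"
    define e where "e = m * (\<Sum>i<p. (y i)\<^sup>2) - quad_form p S y"
    \<comment> \<open>Maximality of \<open>u\<close> along the line \<open>u + t y\<close>; only \<open>d = 0\<close> is compatible with all small \<open>t\<close>.\<close>
    have ineq: "2 * t * d \<le> t\<^sup>2 * e" for t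
    proof -
      have "(\<Sum>i<p. (u i + t * y i)\<^sup>2) = (\<Sum>i<p. (u i)\<^sup>2 + 2 * t * (y i * u i) + t\<^sup>2 * (y i)\<^sup>2)"
        by (intro sum.cong) (auto simp: power2_eq_square algebra_simps)
      then have "(\<Sum>i<p. (u i + t * y i)\<^sup>2) = 1 + 2 * t * (\<Sum>i<p. y i * u i) + t\<^sup>2 * (\<Sum>i<p. (y i)\<^sup>2)"
        by (simp add: sum.distrib u sum_distrib_left)
      then show ?thesis
        using max[of "\<lambda>i. u i + t * y i"] quad_form_add[OF sym, of p u t y]
        by (simp add: d_def e_def m_def algebra_simps)
    qed
    have "d = 0"
    proof (rule ccontr)
      assume "d \<noteq> 0"
      have "e \<ge> 0" unfolding e_def m_def using max[of y] by simp
      define t where "t = d / (e + 1)"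
      have "2 * (d / (e+1)) * d \<le> (d / (e+1))\<^sup>2 * e" using ineq[of t] by (simp add: t_def)
      also have "\<dots> \<le> (d / (e+1))\<^sup>2 * (e + 1)" by (intro mult_left_mono) auto
      also have "\<dots> = (d / (e+1)) * d" using \<open>e \<ge> 0\<close> by (simp add: power2_eq_square)
      finally have "d * d / (e+1) \<le> 0" by simp
      moreover have "d * d / (e+1) > 0" using \<open>d \<noteq> 0\<close> \<open>e \<ge> 0\<close> 
        by (intro divide_pos_pos) (auto simp: zero_less_mult_iff linorder_neq_iff)
      ultimately show False by simp
    qed
    then show ?thesis by (simp add: d_def)
  qed
  have "S *\<^sub>v vec p u = m \<cdot>\<^sub>v vec p u"
  proof (rule eq_vecI)
    fix i assume i: "i < dim_vec (m \<cdot>\<^sub>v vec p u)"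
    have "(\<Sum>j<p. S $$ (i, j) * u j) = m * u i"
      using crit[of "\<lambda>k. if k = i then 1 else 0"] i
      by (simp add: if_distrib[of "\<lambda>x. x * _"] sum.delta cong: if_cong)
    then show "vec_index (S *\<^sub>v vec p u) i = vec_index (m \<cdot>\<^sub>v vec p u) i"
      using i mult_mat_vec_entry[OF S] by simp
  qed (use S in auto)
  moreover have "vec p u \<noteq> 0\<^sub>v p"
  proof
    assume "vec p u = 0\<^sub>v p"
    then have "(\<Sum>i<p. (u i)\<^sup>2) = 0" by (simp add: vec_eq_zero_iff)
    with u show False by simp
  qed
  ultimately have "eigenvector S (vec p u) m"
    using S by (simp add: eigenvector_def)
  then have "m \<in> spectrum S" by (auto simp: spectrum_def eigenvalue_def)
  then show thesis using that max unfolding m_def by blast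
qed

lemma quad_form_le_lambda_max:
  assumes p: "p \<ge> 1" and S: "S \<in> carrier_mat p p"
    and sym: "\<And>i j. i < p \<Longrightarrow> j < p \<Longrightarrow> S $$ (i, j) = S $$ (j, i)"
  shows "quad_form p S x \<le> lambda_max S * (\<Sum>i<p. (x i)\<^sup>2)"
proof -
  obtain m where m: "m \<in> spectrum S" "\<And>x. quad_form p S x \<le> m * (\<Sum>i<p. (x i)\<^sup>2)"
    using rayleigh_max_eigenvalue[OF assms] by blast
  have "m \<le> lambda_max S"
    unfolding lambda_max_def using card_finite_spectrum(1)[OF S] m(1) by simp
  then show ?thesis using m(2)[of x] mult_right_mono[of m "lambda_max S" "\<Sum>i<p. (x i)\<^sup>2"]
    by (meson order_trans sum_nonneg zero_le_power2)
qed

text \<open>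
  The sum of squares of row \<open>i\<close> is the diagonal entry \<open>i\<close> of \<open>A A\<^sup>T\<close>, a value of its Rayleigh
  quotient. Unlike the spectral norm itself, this lower bound is visibly measurable in \<open>A\<close> and is a
  sum over coordinates, as Assouad's argument needs.
\<close>

lemma row_sum_squares_le_spectral_norm:
  assumes A: "A \<in> carrier_mat p p" and i: "i < p"
  shows "(\<Sum>j<p. (A $$ (i, j))\<^sup>2) \<le> (spectral_norm A)\<^sup>2"
proof -
  let ?B = "A * transpose_mat A"
  have B: "?B \<in> carrier_mat p p" using A by auto
  have Bij: "?B $$ (a, b) = (\<Sum>j<p. A $$ (a, j) * A $$ (b, j))" if "a < p" "b < p" for a b
    using A that by (simp add: scalar_prod_def lessThan_atLeast0)
  have "quad_form p ?B (\<lambda>l. if l = i then 1 else 0) = ?B $$ (i, i)"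
    using i by (simp add: quad_form_def if_distrib[of "\<lambda>x. _ * x"] sum.delta cong: if_cong)
  moreover have "quad_form p ?B (\<lambda>l. if l = i then 1 else 0) \<le>
     lambda_max ?B * (\<Sum>l<p. (if l = i then 1 else 0)\<^sup>2)"
    using i by (intro quad_form_le_lambda_max B) (auto simp: Bij mult.commute)
  moreover have "(\<Sum>l<p. (if l = i then 1 else 0 :: real)\<^sup>2) = 1"
    using i by (simp add: if_distrib[of "\<lambda>x. x\<^sup>2"] sum.delta cong: if_cong)
  ultimately have le: "(\<Sum>j<p. (A $$ (i, j))\<^sup>2) \<le> lambda_max ?B"
    using Bij[OF i i] by (simp add: power2_eq_square)
  moreover have "0 \<le> (\<Sum>j<p. (A $$ (i, j))\<^sup>2)" by (intro sum_nonneg) auto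
  ultimately have "lambda_max ?B \<ge> 0" by linarith
  then show ?thesis using le by (simp add: spectral_norm_def)
qed

text \<open>
  Bounds on the quadratic form bound all eigenvalues; since the spectrum is nonempty, they also
  bound its maximum and minimum.
\<close>

lemma banded_covI:
  assumes p: "p \<ge> 1" and S: "S \<in> carrier_mat p p" and M1: "0 < M1"
    and sym: "\<And>i j. i < p \<Longrightarrow> j < p \<Longrightarrow> S $$ (i, j) = S $$ (j, i)"
    and band: "\<And>i j. i < p \<Longrightarrow> j < p \<Longrightarrow> \<bar>int i - int j\<bar> > int k \<Longrightarrow> S $$ (i, j) = 0"
    and lower: "\<And>x. M1 * (\<Sum>i<p. (x i)\<^sup>2) \<le> quad_form p S x"
    and upper: "\<And>x. quad_form p S x \<le> M0 * (\<Sum>i<p. (x i)\<^sup>2)"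
  shows "S \<in> banded_cov p k M0 M1"
proof -
  have pos: "(\<Sum>i<p. (x i)\<^sup>2) > 0" if "\<exists>i<p. x i \<noteq> 0" for x :: "nat \<Rightarrow> real"
    using that by (metis (no_types, lifting) finite_lessThan lessThan_iff sum_pos2 zero_le_power2 zero_less_power2)
  have "quad_form p S x > 0" if "\<exists>i<p. x i \<noteq> 0" for x
    using lower[of x] mult_pos_pos[OF M1 pos[OF that]] by linarith
  then have pd: "S \<in> pos_def_mats p" using S sym by (simp add: pos_def_mats_iff)
  have bounds: "M1 \<le> m \<and> m \<le> M0" if "m \<in> spectrum S" for m
  proof -
    from that obtain x where x: "\<exists>i<p. x i \<noteq> 0" "quad_form p S x = m * (\<Sum>i<p. (x i)\<^sup>2)"
      using eigenvalue_quad_form[OF S, of m] unfolding spectrum_def by blast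
    show ?thesis using lower[of x] upper[of x] x(2) pos[OF x(1)] by simp
  qed
  obtain m where "m \<in> spectrum S" using rayleigh_max_eigenvalue[OF p S sym] by metis
  then have "spectrum S \<noteq> {}" by auto
  then have "lambda_max S \<le> M0" "lambda_min S \<ge> M1"
    unfolding lambda_max_def lambda_min_def using card_finite_spectrum(1)[OF S] bounds by auto
  then show ?thesis using pd band by (auto simp: banded_cov_def)
qed

section \<open>Gaussian integrals with a positive definite quadratic form\<close>

text \<open>
  The Schur complement of the last diagonal entry: what remains of the quadratic form after the
  square in the last variable has been completed.
\<close>

definition schur_complement :: "nat \<Rightarrow> real mat \<Rightarrow> real mat" where
  "schur_complement p S = mat p p (\<lambda>(i, j). S $$ (i, j) - S $$ (i, p) * S $$ (p, j) / S $$ (p, p))"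

lemma det_schur_complement:
  assumes S: "S \<in> carrier_mat (Suc p) (Suc p)" and d: "S $$ (p, p) \<noteq> 0"
  shows "Determinant.det S = S $$ (p, p) * Determinant.det (schur_complement p S)"
proof -
  define u where "u = mat p 1 (\<lambda>(i, j). S $$ (i, p) / S $$ (p, p))"
  define r where "r = mat 1 p (\<lambda>(i, j). S $$ (p, j))"
  define c where "c = mat 1 1 (\<lambda>(i, j). S $$ (p, p))"
  \<comment> \<open>\<open>S = U V\<close> with \<open>U\<close> unit upper triangular and \<open>V\<close> block lower triangular.\<close>
  define U where "U = four_block_mat (1\<^sub>m p) u (0\<^sub>m 1 p) (1\<^sub>m 1)"
  define V where "V = four_block_mat (schur_complement p S) (0\<^sub>m p 1) r c"
  have carr: "schur_complement p S \<in> carrier_mat p p" "u \<in> carrier_mat p 1" "r \<in> carrier_mat 1 p" "c \<in> carrier_mat 1 1"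
    by (auto simp: schur_complement_def u_def r_def c_def)
  have UV: "U * V = four_block_mat (1\<^sub>m p * schur_complement p S + u * r) (1\<^sub>m p * 0\<^sub>m p 1 + u * c)
      (0\<^sub>m 1 p * schur_complement p S + 1\<^sub>m 1 * r) (0\<^sub>m 1 p * 0\<^sub>m p 1 + 1\<^sub>m 1 * c)"
    unfolding U_def V_def by (rule mult_four_block_mat) (use carr in auto)
  have "S = U * V"
  proof (rule eq_matI)
    fix i j assume ij: "i < dim_row (U * V)" "j < dim_col (U * V)"
    then have "i < Suc p" "j < Suc p" using carr by (auto simp: U_def V_def)
    then consider "i < p" "j < p" | "i < p" "j = p" | "i = p" "j < p" | "i = p" "j = p" by linarith
    then show "S $$ (i, j) = (U * V) $$ (i, j)"
      unfolding UV using S carr d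
      by cases (auto simp: schur_complement_def u_def r_def c_def scalar_prod_def)
  qed (use S carr in \<open>auto simp: U_def V_def\<close>)
  moreover have "Determinant.det U = 1"
    unfolding U_def using carr by (subst det_four_block_mat_lower_left_zero) auto
  moreover have "Determinant.det V = Determinant.det (schur_complement p S) * S $$ (p, p)"
    unfolding V_def using carr
    by (subst det_four_block_mat_upper_right_zero_col[where n = p]) (auto simp: c_def det_single)
  moreover have "U \<in> carrier_mat (p + 1) (p + 1)" "V \<in> carrier_mat (p + 1) (p + 1)"
    unfolding U_def V_def using carr by (auto intro!: four_block_carrier_mat)
  ultimately show ?thesis by (simp add: det_mult)
qed

lemma quad_form_complete_square:
  assumes sym: "\<And>i j. i < Suc p \<Longrightarrow> j < Suc p \<Longrightarrow> S $$ (i, j) = S $$ (j, i)"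
    and d: "S $$ (p, p) \<noteq> 0"
  shows "quad_form (Suc p) S (x(p := t)) =
    S $$ (p, p) * (t + (\<Sum>j<p. S $$ (p, j) * x j) / S $$ (p, p))\<^sup>2 + quad_form p (schur_complement p S) x"
proof -
  define b where "b = (\<Sum>j<p. S $$ (p, j) * x j)"
  define d' where "d' = S $$ (p, p)"
  have b': "(\<Sum>i<p. S $$ (i, p) * x i) = b"
    unfolding b_def by (intro sum.cong) (auto simp: sym)
  have "quad_form (Suc p) S (x(p := t)) =
     (\<Sum>i<p. (\<Sum>j<p. S $$ (i, j) * x i * x j) + S $$ (i, p) * x i * t) + (\<Sum>j<p. S $$ (p, j) * t * x j) + d' * t * t"
    by (simp add: quad_form_def d'_def)
  also have "\<dots> = (\<Sum>i<p. \<Sum>j<p. S $$ (i, j) * x i * x j) + 2 * b * t + d' * t\<^sup>2"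
  proof -
    have "(\<Sum>i<p. S $$ (i, p) * x i * t) = b * t" by (simp add: b'[symmetric] sum_distrib_right)
    moreover have "(\<Sum>j<p. S $$ (p, j) * t * x j) = b * t"
      unfolding b_def sum_distrib_right by (intro sum.cong) (simp_all add: mult_ac)
    ultimately show ?thesis by (simp add: sum.distrib power2_eq_square)
  qed
  also have "(\<Sum>i<p. \<Sum>j<p. S $$ (i, j) * x i * x j) = quad_form p (schur_complement p S) x + b\<^sup>2 / d'"
  proof -
    have "quad_form p (schur_complement p S) x =
      (\<Sum>i<p. \<Sum>j<p. S $$ (i, j) * x i * x j - (S $$ (i, p) * x i) * (S $$ (p, j) * x j) / d')"
      by (simp add: quad_form_def schur_complement_def d'_def algebra_simps)
    also have "\<dots> = (\<Sum>i<p. \<Sum>j<p. S $$ (i, j) * x i * x j) - (\<Sum>i<p. \<Sum>j<p. (S $$ (i, p) * x i) * (S $$ (p, j) * x j)) / d'"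
      by (simp add: sum_subtractf sum_divide_distrib)
    also have "(\<Sum>i<p. \<Sum>j<p. (S $$ (i, p) * x i) * (S $$ (p, j) * x j)) = b\<^sup>2"
      unfolding power2_eq_square sum_product[symmetric] b' by (simp add: b_def)
    finally show ?thesis by simp
  qed
  also have "quad_form p (schur_complement p S) x + b\<^sup>2 / d' + 2 * b * t + d' * t\<^sup>2 =
      d' * (t + b / d')\<^sup>2 + quad_form p (schur_complement p S) x"
    using d unfolding d'_def[symmetric] by (simp add: field_simps power2_eq_square)
  finally show ?thesis unfolding b_def d'_def .
qed

lemma schur_complement_pos_def:
  assumes S: "S \<in> pos_def_mats (Suc p)"
  shows "S $$ (p, p) > 0" "schur_complement p S \<in> pos_def_mats p"
proof -
  from S have sym: "\<And>i j. i < Suc p \<Longrightarrow> j < Suc p \<Longrightarrow> S $$ (i, j) = S $$ (j, i)"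
    and pos: "\<And>x. \<exists>i<Suc p. x i \<noteq> 0 \<Longrightarrow> quad_form (Suc p) S x > 0"
    unfolding pos_def_mats_iff by blast+
  have "quad_form (Suc p) S (\<lambda>i. if i = p then 1 else 0) = S $$ (p, p)"
    by (simp add: quad_form_def)
  then show d: "S $$ (p, p) > 0" using pos[of "\<lambda>i. if i = p then 1 else 0"] by fastforce
  have "quad_form p (schur_complement p S) x > 0" if x: "\<exists>i<p. x i \<noteq> 0" for x
  proof -
    define t where "t = - (\<Sum>j<p. S $$ (p, j) * x j) / S $$ (p, p)"
    have "\<exists>i<Suc p. (x(p := t)) i \<noteq> 0" using x by (metis fun_upd_other less_SucI nat_neq_iff)
    moreover have "quad_form (Suc p) S (x(p := t)) = quad_form p (schur_complement p S) x"
      using quad_form_complete_square[OF sym, of p x t] d by (simp add: t_def)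
    ultimately show ?thesis using pos by metis
  qed
  then show "schur_complement p S \<in> pos_def_mats p"
    unfolding pos_def_mats_iff using sym by (auto simp: schur_complement_def)
qed

lemma det_pos_def: "S \<in> pos_def_mats p \<Longrightarrow> Determinant.det S > 0"
proof (induction p arbitrary: S)
  case 0
  then show ?case by (auto simp: pos_def_mats_def det_dim_zero)
next
  case (Suc p)
  from schur_complement_pos_def[OF Suc.prems] Suc.IH det_schur_complement[of S p] Suc.prems
  show ?case by (auto simp: pos_def_mats_def)
qed

lemma measurable_quad_form [measurable]:
  "quad_form p S \<in> borel_measurable (PiM {..<p} (\<lambda>_. lborel))"
  unfolding quad_form_def by (intro borel_measurable_sum borel_measurable_times) auto

lemma nn_integral_normal_density:
  assumes "s > 0"
  shows "(\<integral>\<^sup>+ x. ennreal (normal_density m s x) \<partial>lborel) = 1"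
proof -
  interpret prob_space "density lborel (normal_density m s)"
    using assms by (rule prob_space_normal_density)
  show ?thesis using emeasure_space_1 by (simp add: emeasure_density)
qed

lemma nn_integral_gaussian:
  assumes d: "d > 0"
  shows "(\<integral>\<^sup>+ t. ennreal (exp (- (d * (t + c)\<^sup>2) / 2)) \<partial>lborel) = ennreal (sqrt (2 * pi / d))"
proof -
  have "ennreal (exp (- (d * (t + c)\<^sup>2) / 2)) = ennreal (sqrt (2 * pi / d)) * ennreal (normal_density (- c) (1 / sqrt d) t)" for t
    using d by (simp add: normal_density_def ennreal_mult[symmetric] real_sqrt_divide real_sqrt_mult power_divide field_simps)
  then show ?thesis
    using nn_integral_normal_density[of "1 / sqrt d" "- c"] d by (simp add: nn_integral_cmult)
qed

interpretation lborel_product: product_sigma_finite "\<lambda>_::nat. lborel :: real measure" ..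

text \<open>
  Integrate the last variable first: completing the square leaves a one-dimensional Gaussian
  integral times the Gaussian of the Schur complement, and the determinant splits in the same way.
\<close>

lemma nn_integral_gaussian_quad_form:
  assumes "S \<in> pos_def_mats p"
  shows "(\<integral>\<^sup>+ x. ennreal (exp (- quad_form p S x / 2)) \<partial>PiM {..<p} (\<lambda>_. lborel)) =
    ennreal (sqrt ((2 * pi) ^ p / Determinant.det S))"
  using assms
proof (induction p arbitrary: S)
  case 0
  then have "Determinant.det S = 1" by (auto simp: pos_def_mats_def det_dim_zero)
  then show ?case by (simp add: quad_form_def PiM_empty)
next
  case (Suc p)
  let ?Q = "schur_complement p S" and ?d = "S $$ (p, p)"
  let ?c = "\<lambda>x. (\<Sum>j<p. S $$ (p, j) * x j) / ?d"
  note d = schur_complement_pos_def(1)[OF Suc.prems] and Q = schur_complement_pos_def(2)[OF Suc.prems]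
  have sym: "\<And>i j. i < Suc p \<Longrightarrow> j < Suc p \<Longrightarrow> S $$ (i, j) = S $$ (j, i)" and S: "S \<in> carrier_mat (Suc p) (Suc p)"
    using Suc.prems unfolding pos_def_mats_iff by blast+
  have split: "ennreal (exp (- quad_form (Suc p) S (x(p := t)) / 2)) =
      ennreal (exp (- (?d * (t + ?c x)\<^sup>2) / 2)) * ennreal (exp (- quad_form p ?Q x / 2))" for x t
    using quad_form_complete_square[OF sym, of p x t] d
    by (simp add: ennreal_mult[symmetric] exp_add[symmetric] field_simps)
  have "(\<integral>\<^sup>+ x. ennreal (exp (- quad_form (Suc p) S x / 2)) \<partial>PiM {..<Suc p} (\<lambda>_. lborel)) =
     (\<integral>\<^sup>+ x. (\<integral>\<^sup>+ t. ennreal (exp (- quad_form (Suc p) S (x(p := t)) / 2)) \<partial>lborel) \<partial>PiM {..<p} (\<lambda>_. lborel))"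
    unfolding lessThan_Suc
    by (rule lborel_product.product_nn_integral_insert) (auto simp flip: lessThan_Suc)
  also have "\<dots> = (\<integral>\<^sup>+ x. ennreal (sqrt (2 * pi / ?d)) * ennreal (exp (- quad_form p ?Q x / 2)) \<partial>PiM {..<p} (\<lambda>_. lborel))"
    unfolding split by (intro nn_integral_cong, subst nn_integral_multc)
      (simp, simp only: nn_integral_gaussian[OF d])
  also have "\<dots> = ennreal (sqrt (2 * pi / ?d)) * ennreal (sqrt ((2 * pi) ^ p / Determinant.det ?Q))"
    using Suc.IH[OF Q] by (simp add: nn_integral_cmult del: minus_divide_left power_mult_distrib)
  also have "\<dots> = ennreal (sqrt ((2 * pi) ^ Suc p / Determinant.det S))"
    using d det_pos_def[OF Q] det_schur_complement[OF S]
    by (simp add: ennreal_mult[symmetric] real_sqrt_mult[symmetric] mult_ac)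
  finally show ?case .
qed

text \<open>
  The inverse in the Gaussian density is computed by Gauss-Jordan elimination. The cofactor formula
  for its entries makes it measurable as a function of the matrix.
\<close>

lemma pos_def_inverse:
  assumes S: "S \<in> pos_def_mats p"
  obtains B where "the (mat_inverse S) = B" "S * B = 1\<^sub>m p" "B * S = 1\<^sub>m p" "B \<in> pos_def_mats p"
    "\<And>i j. i < p \<Longrightarrow> j < p \<Longrightarrow> B $$ (i, j) = cofactor S j i / Determinant.det S"
proof -
  have Sc: "S \<in> carrier_mat p p" and ST: "transpose_mat S = S"
    and pos: "\<And>v. v \<in> carrier_vec p \<Longrightarrow> v \<noteq> 0\<^sub>v p \<Longrightarrow> scalar_prod v (S *\<^sub>v v) > 0"
    using S by (auto simp: pos_def_mats_def)
  have det: "Determinant.det S > 0" using S by (rule det_pos_def)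
  define A where "A = (1 / Determinant.det S) \<cdot>\<^sub>m adj_mat S"
  have A: "A \<in> carrier_mat p p" and SA: "S * A = 1\<^sub>m p" "A * S = 1\<^sub>m p"
    using adj_mat[OF Sc] Sc det
    by (auto simp: A_def mult_smult_distrib mult_smult_assoc_mat smult_smult_assoc intro!: eq_matI)
  have "mat_inverse S \<noteq> None"
  proof
    assume "mat_inverse S = None"
    then have "S \<notin> Units (ring_mat TYPE(real) p ())" by (rule mat_inverse(1)[OF Sc])
    then show False using A SA Sc by (auto simp: Units_def ring_mat_def)
  qed
  then obtain B where B: "mat_inverse S = Some B" by auto
  then have SB: "S * B = 1\<^sub>m p" "B * S = 1\<^sub>m p" and Bc: "B \<in> carrier_mat p p"
    using mat_inverse(2)[OF Sc B] by auto
  have "B = A"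
    using assoc_mult_mat[OF Bc Sc A] SA(1) SB(2) A Bc by simp
  have "transpose_mat B * S = 1\<^sub>m p"
    using transpose_mult[OF Sc Bc] ST SB by (simp add: transpose_one)
  then have BT: "transpose_mat B = B"
    using assoc_mult_mat[of "transpose_mat B" p p S p B p] SB(1) Sc Bc by simp
  have "scalar_prod v (B *\<^sub>v v) > 0" if v: "v \<in> carrier_vec p" "v \<noteq> 0\<^sub>v p" for v
  proof -
    let ?w = "B *\<^sub>v v"
    have w: "?w \<in> carrier_vec p" using Bc v by auto
    have Sw: "S *\<^sub>v ?w = v"
      using assoc_mult_mat_vec[OF Sc Bc v(1)] v(1) SB(1) by simp
    have "S *\<^sub>v 0\<^sub>v p = 0\<^sub>v p" using Sc by (intro eq_vecI) auto
    with Sw have "?w \<noteq> 0\<^sub>v p" using v(2) by metis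
    from pos[OF w this] show ?thesis unfolding Sw using comm_scalar_prod[OF v(1) w] by simp
  qed
  then have "B \<in> pos_def_mats p" using Bc BT by (simp add: pos_def_mats_def)
  moreover have "B $$ (i, j) = cofactor S j i / Determinant.det S" if "i < p" "j < p" for i j
    using that Sc unfolding \<open>B = A\<close> A_def by (simp add: adj_mat_def)
  ultimately show thesis using that SB B by auto
qed

lemma mvn_density_quad_form:
  assumes S: "S \<in> pos_def_mats p"
  shows "mvn_density p S x =
    exp (- quad_form p (the (mat_inverse S)) x / 2) / sqrt ((2 * pi) ^ p * Determinant.det S)"
proof -
  obtain B where "the (mat_inverse S) = B" "B \<in> pos_def_mats p"
    using pos_def_inverse[OF S] by metis
  then show ?thesis
    using scalar_prod_eq_quad_form[of B p x] by (simp add: mvn_density_def pos_def_mats_def)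
qed

lemma mvn_density_pos: "S \<in> pos_def_mats p \<Longrightarrow> mvn_density p S x > 0"
  using det_pos_def[of S p] by (simp add: mvn_density_quad_form)

lemma measurable_mvn_density [measurable]:
  assumes S: "S \<in> pos_def_mats p"
  shows "mvn_density p S \<in> borel_measurable (PiM {..<p} (\<lambda>_. lborel))"
  unfolding mvn_density_quad_form[OF S] by simp

lemma nn_integral_mvn_density:
  assumes S: "S \<in> pos_def_mats p"
  shows "(\<integral>\<^sup>+ x. ennreal (mvn_density p S x) \<partial>PiM {..<p} (\<lambda>_. lborel)) = 1"
proof -
  obtain B where B: "the (mat_inverse S) = B" "S * B = 1\<^sub>m p" "B \<in> pos_def_mats p"
    using pos_def_inverse[OF S] by metis
  have d: "Determinant.det S > 0" "Determinant.det B > 0" using S B det_pos_def by auto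
  have "Determinant.det S * Determinant.det B = 1"
    using det_mult[of S p B] S B by (simp add: pos_def_mats_def)
  then have dB: "Determinant.det B = 1 / Determinant.det S" using d by (simp add: field_simps)
  have "(\<integral>\<^sup>+ x. ennreal (mvn_density p S x) \<partial>PiM {..<p} (\<lambda>_. lborel)) =
    (\<integral>\<^sup>+ x. ennreal (exp (- quad_form p B x / 2)) * ennreal (1 / sqrt ((2 * pi) ^ p * Determinant.det S)) \<partial>PiM {..<p} (\<lambda>_. lborel))"
    unfolding mvn_density_quad_form[OF S] B(1) using d by (simp add: ennreal_mult[symmetric])
  also have "\<dots> = ennreal (sqrt ((2 * pi) ^ p / Determinant.det B)) * ennreal (1 / sqrt ((2 * pi) ^ p * Determinant.det S))"
    using nn_integral_gaussian_quad_form[OF B(3)]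
    by (simp add: nn_integral_multc del: minus_divide_left power_mult_distrib)
  also have "\<dots> = 1"
    using d by (simp add: ennreal_mult[symmetric] dB)
  finally show ?thesis .
qed

section \<open>Risk of a posterior as a randomised estimator\<close>

text \<open>
  Both measures are determined by their values on boxes, where the integral of the product density
  factorises.
\<close>

lemma (in product_sigma_finite) PiM_density:
  assumes I: "finite I" and f: "\<And>i. f i \<in> borel_measurable (M i)"
    and sf: "\<And>i. sigma_finite_measure (density (M i) (f i))"
  shows "PiM I (\<lambda>i. density (M i) (f i)) = density (PiM I M) (\<lambda>x. \<Prod>i\<in>I. f i (x i))"
proof -
  interpret D: product_sigma_finite "\<lambda>i. density (M i) (f i)"
    using sf by (simp add: product_sigma_finite_def)
  note f[measurable]
  show ?thesis
  proof (rule D.PiM_eqI[OF I, symmetric])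
    show "sets (density (PiM I M) (\<lambda>x. \<Prod>i\<in>I. f i (x i))) = sets (PiM I (\<lambda>i. density (M i) (f i)))"
      by (auto intro!: sets_PiM_cong)
    fix A assume "\<And>i. i \<in> I \<Longrightarrow> A i \<in> sets (density (M i) (f i))"
    then have A [measurable]: "\<And>i. i \<in> I \<Longrightarrow> A i \<in> sets (M i)" by simp
    have [measurable]: "Pi\<^sub>E I A \<in> sets (PiM I M)" using I A by (intro sets_PiM_I_finite)
    have ind: "(\<Prod>i\<in>I. f i (x i)) * indicator (Pi\<^sub>E I A) x = (\<Prod>i\<in>I. f i (x i) * indicator (A i) (x i))"
      if x: "x \<in> space (PiM I M)" for x
    proof (cases "x \<in> Pi\<^sub>E I A")
      case True
      then show ?thesis by (auto intro!: prod.cong simp: PiE_iff)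
    next
      case False
      then obtain i where "i \<in> I" "x i \<notin> A i" using x by (auto simp: space_PiM PiE_iff)
      then have "(\<Prod>i\<in>I. f i (x i) * indicator (A i) (x i)) = 0" using I
        by (intro prod_zero bexI[of _ i]) auto
      then show ?thesis using False by simp
    qed
    have "emeasure (density (PiM I M) (\<lambda>x. \<Prod>i\<in>I. f i (x i))) (Pi\<^sub>E I A) =
       (\<integral>\<^sup>+ x. (\<Prod>i\<in>I. f i (x i)) * indicator (Pi\<^sub>E I A) x \<partial>PiM I M)"
      by (rule emeasure_density) auto
    also have "\<dots> = (\<integral>\<^sup>+ x. (\<Prod>i\<in>I. f i (x i) * indicator (A i) (x i)) \<partial>PiM I M)"
      by (intro nn_integral_cong ind)
    also have "\<dots> = (\<Prod>i\<in>I. \<integral>\<^sup>+ y. f i y * indicator (A i) y \<partial>M i)"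
      by (rule product_nn_integral_prod[OF I]) measurable
    also have "\<dots> = (\<Prod>i\<in>I. emeasure (density (M i) (f i)) (A i))"
      by (intro prod.cong refl) (simp add: emeasure_density)
    finally show "emeasure (density (PiM I M) (\<lambda>x. \<Prod>i\<in>I. f i (x i))) (Pi\<^sub>E I A) = \<dots>" .
  qed
qed

abbreviation lebesgue_vec :: "nat \<Rightarrow> (nat \<Rightarrow> real) measure" where
  "lebesgue_vec p \<equiv> PiM {..<p} (\<lambda>_. lborel)"

abbreviation lebesgue_sample :: "nat \<Rightarrow> nat \<Rightarrow> (nat \<Rightarrow> nat \<Rightarrow> real) measure" where
  "lebesgue_sample n p \<equiv> PiM {..<n} (\<lambda>_. lebesgue_vec p)"

lemma product_sigma_finite_lebesgue_vec: "product_sigma_finite (\<lambda>_::nat. lebesgue_vec p)"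
  unfolding product_sigma_finite_def using lborel_product.sigma_finite[of "{..<p}"] by simp

lemma sigma_finite_lebesgue_sample: "sigma_finite_measure (lebesgue_sample n p)"
proof -
  interpret product_sigma_finite "\<lambda>_::nat. lebesgue_vec p" by (rule product_sigma_finite_lebesgue_vec)
  show ?thesis by (rule sigma_finite) simp
qed

lemma nn_integral_sample_prod:
  assumes [measurable]: "h \<in> borel_measurable (lebesgue_vec p)"
  shows "(\<integral>\<^sup>+ X. (\<Prod>i<n. h (X i)) \<partial>lebesgue_sample n p) = (\<integral>\<^sup>+ x. h x \<partial>lebesgue_vec p) ^ n"
proof -
  interpret product_sigma_finite "\<lambda>_::nat. lebesgue_vec p" by (rule product_sigma_finite_lebesgue_vec)
  show ?thesis by (subst product_nn_integral_prod) auto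
qed

lemma ennreal_likelihood:
  "S \<in> pos_def_mats p \<Longrightarrow> ennreal (likelihood n p X S) = (\<Prod>i<n. ennreal (mvn_density p S (X i)))"
  unfolding likelihood_def by (intro prod_ennreal[symmetric]) (simp add: less_imp_le mvn_density_pos)

lemma likelihood_pos: "S \<in> pos_def_mats p \<Longrightarrow> likelihood n p X S > 0"
  by (auto simp: likelihood_def intro!: prod_pos mvn_density_pos)

lemma measurable_likelihood [measurable]:
  "S \<in> pos_def_mats p \<Longrightarrow> (\<lambda>X. likelihood n p X S) \<in> borel_measurable (lebesgue_sample n p)"
  unfolding likelihood_def by measurable

lemma nn_integral_likelihood:
  assumes "S \<in> pos_def_mats p"
  shows "(\<integral>\<^sup>+ X. ennreal (likelihood n p X S) \<partial>lebesgue_sample n p) = 1"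
  using assms nn_integral_sample_prod[of "\<lambda>x. ennreal (mvn_density p S x)" p n]
  by (simp add: ennreal_likelihood nn_integral_mvn_density)

lemma sample_dist_eq_density:
  assumes S: "S \<in> pos_def_mats p"
  shows "sample_dist n p S = density (lebesgue_sample n p) (\<lambda>X. ennreal (likelihood n p X S))"
proof -
  interpret product_sigma_finite "\<lambda>_::nat. lebesgue_vec p" by (rule product_sigma_finite_lebesgue_vec)
  have "prob_space (mvn p S)"
    using S by (intro prob_spaceI) (simp add: mvn_def emeasure_density nn_integral_mvn_density)
  then have "sigma_finite_measure (mvn p S)" by (rule prob_space_imp_sigma_finite)
  then show ?thesis
    unfolding sample_dist_def mvn_def ennreal_likelihood[OF S] using S by (intro PiM_density) auto
qed

lemma space_mat_borel: "space (mat_borel p) = carrier_mat p p"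
  by (simp add: mat_borel_def)

lemma pos_def_mats_carrier: "S \<in> pos_def_mats p \<Longrightarrow> S \<in> carrier_mat p p"
  by (simp add: pos_def_mats_def)

lemma space_pos_def_borel: "space (pos_def_borel p) = pos_def_mats p"
  by (auto simp: pos_def_borel_def space_restrict_space space_mat_borel pos_def_mats_carrier)

lemma measurable_mat_entry:
  assumes "i < p" "j < p"
  shows "(\<lambda>A. A $$ (i, j)) \<in> borel_measurable (mat_borel p)"
proof -
  have "(\<lambda>A. \<lambda>ij \<in> {..<p} \<times> {..<p}. A $$ ij) \<in> measurable (mat_borel p) (PiM ({..<p} \<times> {..<p}) (\<lambda>_. borel))"
    unfolding mat_borel_def by (rule measurable_vimage_algebra1) (auto simp: space_PiM)
  from measurable_compose[OF this measurable_component_singleton[of "(i, j)"]]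
  show ?thesis using assms by simp
qed

lemma measurable_pos_def_entry:
  "i < p \<Longrightarrow> j < p \<Longrightarrow> (\<lambda>A. A $$ (i, j)) \<in> borel_measurable (pos_def_borel p)"
  unfolding pos_def_borel_def by (intro measurable_restrict_space1 measurable_mat_entry)

lemma measurable_det:
  assumes "\<And>z. z \<in> space N \<Longrightarrow> F z \<in> carrier_mat m m"
    and "\<And>i j. i < m \<Longrightarrow> j < m \<Longrightarrow> (\<lambda>z. F z $$ (i, j)) \<in> borel_measurable N"
  shows "(\<lambda>z. Determinant.det (F z) :: real) \<in> borel_measurable N"
proof -
  have "(\<lambda>z. \<Sum>q \<in> {q. q permutes {0..<m}}. signof q * (\<Prod>i = 0..<m. F z $$ (i, q i))) \<in> borel_measurable N"
    by (intro borel_measurable_sum borel_measurable_times borel_measurable_prod assms(2)) (auto simp: permutes_in_image)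
  moreover have "Determinant.det (F z) = (\<Sum>q \<in> {q. q permutes {0..<m}}. signof q * (\<Prod>i = 0..<m. F z $$ (i, q i)))"
    if "z \<in> space N" for z using assms(1)[OF that] by (rule det_def')
  ultimately show ?thesis by (simp cong: measurable_cong)
qed

lemma measurable_pos_def_det:
  "Determinant.det \<in> borel_measurable (pos_def_borel p)"
  using measurable_det[of "pos_def_borel p" "\<lambda>S. S" p] measurable_pos_def_entry[of _ p]
  by (simp add: space_pos_def_borel pos_def_mats_carrier)

lemma measurable_cofactor:
  assumes "i < p" "j < p"
  shows "(\<lambda>S. cofactor S i j) \<in> borel_measurable (pos_def_borel p)"
proof -
  have "(\<lambda>S. Determinant.det (mat_delete S i j) :: real) \<in> borel_measurable (pos_def_borel p)"
  proof (rule measurable_det[where m = "p - 1"])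
    fix S :: "real mat" assume "S \<in> space (pos_def_borel p)"
    then show "mat_delete S i j \<in> carrier_mat (p - 1) (p - 1)"
      by (auto simp: space_pos_def_borel dest!: pos_def_mats_carrier intro: mat_delete_carrier)
  next
    fix a b assume ab: "a < p - 1" "b < p - 1"
    have "(\<lambda>S. S $$ (if a < i then a else Suc a, if b < j then b else Suc b)) \<in> borel_measurable (pos_def_borel p)"
      using ab by (intro measurable_pos_def_entry) auto
    moreover have "mat_delete S i j $$ (a, b) = S $$ (if a < i then a else Suc a, if b < j then b else Suc b)"
      if "S \<in> space (pos_def_borel p)" for S :: "real mat"
      using that ab pos_def_mats_carrier[of S p] by (auto simp: space_pos_def_borel mat_delete_def)
    ultimately show "(\<lambda>S. mat_delete S i j $$ (a, b) :: real) \<in> borel_measurable (pos_def_borel p)"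
      by (simp cong: measurable_cong)
  qed
  then show ?thesis unfolding cofactor_def by (intro borel_measurable_times borel_measurable_const)
qed

text \<open>
  Joint measurability in the observation and the covariance matrix is what Tonelli's theorem needs
  below; it holds because determinant and cofactors are polynomials in the entries.
\<close>

lemma measurable_mvn_density_joint:
  assumes F: "F \<in> measurable N (pos_def_borel p)" and G: "G \<in> measurable N (lebesgue_vec p)"
  shows "(\<lambda>z. mvn_density p (F z) (G z)) \<in> borel_measurable N"
proof -
  have [measurable]: "(\<lambda>z. Determinant.det (F z)) \<in> borel_measurable N"
    using F measurable_pos_def_det by (rule measurable_compose)
  have "(\<lambda>z. exp (- (\<Sum>i<p. \<Sum>j<p. cofactor (F z) j i / Determinant.det (F z) * G z i * G z j) / 2) /
      sqrt ((2 * pi) ^ p * Determinant.det (F z))) \<in> borel_measurable N"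
  proof -
    have [measurable]: "(\<lambda>z. \<Sum>i<p. \<Sum>j<p. cofactor (F z) j i / Determinant.det (F z) * G z i * G z j) \<in> borel_measurable N"
    proof (intro borel_measurable_sum)
      fix i j assume ij: "i \<in> {..<p}" "j \<in> {..<p}"
      have [measurable]: "(\<lambda>z. cofactor (F z) j i) \<in> borel_measurable N"
        using measurable_compose[OF F measurable_cofactor[of j p i]] ij by simp
      have [measurable]: "(\<lambda>z. G z i) \<in> borel_measurable N" "(\<lambda>z. G z j) \<in> borel_measurable N"
        using measurable_compose[OF G measurable_component_singleton] ij by auto
      show "(\<lambda>z. cofactor (F z) j i / Determinant.det (F z) * G z i * G z j) \<in> borel_measurable N"
        by measurable
    qed
    show ?thesis by measurable
  qed
  moreover have "mvn_density p (F z) (G z) =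
      exp (- (\<Sum>i<p. \<Sum>j<p. cofactor (F z) j i / Determinant.det (F z) * G z i * G z j) / 2) /
      sqrt ((2 * pi) ^ p * Determinant.det (F z))" if "z \<in> space N" for z
  proof -
    have "F z \<in> pos_def_mats p" using measurable_space[OF F that] by (simp add: space_pos_def_borel)
    then obtain B where B: "the (mat_inverse (F z)) = B"
      "\<And>i j. i < p \<Longrightarrow> j < p \<Longrightarrow> B $$ (i, j) = cofactor (F z) j i / Determinant.det (F z)"
      using pos_def_inverse[of "F z" p] by metis
    show ?thesis
      unfolding mvn_density_quad_form[OF \<open>F z \<in> pos_def_mats p\<close>] B(1) quad_form_def by (simp add: B(2))
  qed
  ultimately show ?thesis by (simp cong: measurable_cong)
qed

lemma measurable_likelihood_joint:
  assumes "F \<in> measurable N (pos_def_borel p)" and "G \<in> measurable N (lebesgue_sample n p)"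
  shows "(\<lambda>z. likelihood n p (G z) (F z)) \<in> borel_measurable N"
  unfolding likelihood_def
proof (intro borel_measurable_prod measurable_mvn_density_joint[OF assms(1)])
  fix i assume "i \<in> {..<n}"
  then show "(\<lambda>z. G z i) \<in> measurable N (lebesgue_vec p)"
    using measurable_compose[OF assms(2) measurable_component_singleton[of i]] by simp
qed

text \<open>
  The normalising constant \<open>Z(X)\<close> integrates to \<open>1\<close> over all samples by Tonelli, so it is finite
  almost everywhere; it is positive because the likelihood is. Hence the posterior is a probability
  measure for almost every sample, with respect to Lebesgue measure and so under every hypothesis.
\<close>

lemma AE_posterior_density_normalised:
  assumes "\<pi> \<in> priors p"
  shows "AE X in lebesgue_sample n p.
    (\<integral>\<^sup>+ S. ennreal (likelihood n p X S) / (\<integral>\<^sup>+ T. ennreal (likelihood n p X T) \<partial>\<pi>) \<partial>\<pi>) = 1"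
proof -
  interpret prob_space \<pi> using assms by (simp add: priors_def)
  interpret L: sigma_finite_measure "lebesgue_sample n p" by (rule sigma_finite_lebesgue_sample)
  interpret P: pair_sigma_finite "lebesgue_sample n p" \<pi> ..
  have sets [measurable_cong]: "sets \<pi> = sets (pos_def_borel p)" using assms by (simp add: priors_def)
  have space: "space \<pi> = pos_def_mats p" using sets_eq_imp_space_eq[OF sets] by (simp add: space_pos_def_borel)
  have [measurable]: "(\<lambda>(X, S). likelihood n p X S) \<in> borel_measurable (lebesgue_sample n p \<Otimes>\<^sub>M \<pi>)"
    unfolding split_beta' by (rule measurable_likelihood_joint) auto
  define Z where "Z X = (\<integral>\<^sup>+ T. ennreal (likelihood n p X T) \<partial>\<pi>)" for X
  have Z [measurable]: "Z \<in> borel_measurable (lebesgue_sample n p)" unfolding Z_def by measurable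
  have "(\<integral>\<^sup>+ X. Z X \<partial>lebesgue_sample n p) =
      (\<integral>\<^sup>+ S. \<integral>\<^sup>+ X. ennreal (likelihood n p X S) \<partial>lebesgue_sample n p \<partial>\<pi>)"
    unfolding Z_def by (rule P.Fubini'[symmetric]) simp
  also have "\<dots> = (\<integral>\<^sup>+ S. 1 \<partial>\<pi>)"
    by (intro nn_integral_cong nn_integral_likelihood) (simp add: space)
  also have "\<dots> = 1" by (simp add: emeasure_space_1)
  finally have "AE X in lebesgue_sample n p. Z X \<noteq> \<infinity>"
    by (intro nn_integral_PInf_AE) auto
  moreover have "(\<integral>\<^sup>+ S. ennreal (likelihood n p X S) / Z X \<partial>\<pi>) = 1"
    if X: "X \<in> space (lebesgue_sample n p)" and fin: "Z X \<noteq> \<infinity>" for X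
  proof -
    have [measurable]: "(\<lambda>S. likelihood n p X S) \<in> borel_measurable \<pi>"
      using X by measurable
    have "Z X \<noteq> 0"
    proof
      assume "Z X = 0"
      then have "AE S in \<pi>. ennreal (likelihood n p X S) = 0"
        unfolding Z_def by (subst (asm) nn_integral_0_iff_AE) auto
      moreover have "AE S in \<pi>. ennreal (likelihood n p X S) \<noteq> 0"
        using likelihood_pos[of _ p n X] by (intro AE_I2) (simp add: space ennreal_eq_0_iff not_le)
      ultimately have "AE S in \<pi>. False" by eventually_elim simp
      then show False by simp
    qed
    then show ?thesis using fin
      by (simp add: nn_integral_divide Z_def[symmetric] ennreal_divide_self less_top zero_less_iff_neq_zero)
  qed
  ultimately show ?thesis
    unfolding Z_def[symmetric] using AE_space by (auto elim: eventually_elim2)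
qed

text \<open>
  All risks are integrals of the same kernel, the posterior, against different densities of the
  sample. Hence the weighted risk is one double integral over samples and posterior draws, and a
  pointwise lower bound of its integrand that does not depend on the draw passes to the integral,
  because the posterior has mass one. The functions \<open>g t\<close> stand for measurable lower bounds of the loss.
\<close>

lemma bayes_risk_ge:
  assumes proc: "(\<pi>, f) \<in> pp_procedures p" and T: "finite T"
    and S: "\<And>t. t \<in> T \<Longrightarrow> S t \<in> pos_def_mats p"
    and w: "\<And>t. t \<in> T \<Longrightarrow> 0 \<le> w t"
    and g: "\<And>t. t \<in> T \<Longrightarrow> g t \<in> borel_measurable (mat_borel p)"
    and g_nonneg: "\<And>t A. t \<in> T \<Longrightarrow> 0 \<le> g t A"
    and g_le: "\<And>t A. t \<in> T \<Longrightarrow> A \<in> carrier_mat p p \<Longrightarrow> g t A \<le> (spectral_norm (A - S t))\<^sup>2"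
    and m: "m \<in> borel_measurable (lebesgue_sample n p)"
    and m_le: "\<And>X A. A \<in> carrier_mat p p \<Longrightarrow> m X \<le> (\<Sum>t\<in>T. w t * likelihood n p X (S t) * g t A)"
  shows "(\<integral>\<^sup>+ X. ennreal (m X) \<partial>lebesgue_sample n p) \<le> (\<Sum>t\<in>T. ennreal (w t) * pp_risk n p \<pi> f (S t))"
proof -
  have prior: "\<pi> \<in> priors p" and f: "f \<in> measurable (pos_def_borel p) (mat_borel p)"
    using proc by (auto simp: pp_procedures_def post_functions_def)
  interpret prob_space \<pi> using prior by (simp add: priors_def)
  have sets [measurable_cong]: "sets \<pi> = sets (pos_def_borel p)" using prior by (simp add: priors_def)
  have space: "space \<pi> = pos_def_mats p" using sets_eq_imp_space_eq[OF sets] by (simp add: space_pos_def_borel)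
  let ?L = "lebesgue_sample n p"
  have lik [measurable]: "(\<lambda>(X, S). likelihood n p X S) \<in> borel_measurable (?L \<Otimes>\<^sub>M \<pi>)"
    unfolding split_beta' by (rule measurable_likelihood_joint) auto
  define \<rho> where "\<rho> X S = ennreal (likelihood n p X S) / (\<integral>\<^sup>+ T. ennreal (likelihood n p X T) \<partial>\<pi>)" for X S
  have rho [measurable]: "(\<lambda>(X, S). \<rho> X S) \<in> borel_measurable (?L \<Otimes>\<^sub>M \<pi>)"
    unfolding \<rho>_def by measurable
  have fS: "f R \<in> carrier_mat p p" if "R \<in> space \<pi>" for R
    using measurable_space[OF f, of R] that by (simp add: space space_pos_def_borel space_mat_borel)
  have gf [measurable]: "(\<lambda>R. g t (f R)) \<in> borel_measurable \<pi>" if "t \<in> T" for t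
    using measurable_compose[OF f g[OF that]] by (simp add: measurable_cong_sets[OF sets refl])
  have risk: "(\<integral>\<^sup>+ X. \<integral>\<^sup>+ R. \<rho> X R * ennreal (likelihood n p X (S t) * g t (f R)) \<partial>\<pi> \<partial>?L) \<le> pp_risk n p \<pi> f (S t)"
    if t: "t \<in> T" for t
  proof -
    note [measurable] = gf[OF t]
    have [measurable]: "(\<lambda>X. likelihood n p X (S t)) \<in> borel_measurable ?L" using S[OF t] by simp
    have post: "(\<integral>\<^sup>+ R. ennreal (g t (f R)) \<partial>posterior n p \<pi> X) = (\<integral>\<^sup>+ R. \<rho> X R * ennreal (g t (f R)) \<partial>\<pi>)"
      if "X \<in> space ?L" for X
      unfolding posterior_def \<rho>_def[symmetric] using that by (subst nn_integral_density) auto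
    have "(\<integral>\<^sup>+ X. \<integral>\<^sup>+ R. \<rho> X R * ennreal (likelihood n p X (S t) * g t (f R)) \<partial>\<pi> \<partial>?L) =
       (\<integral>\<^sup>+ X. ennreal (likelihood n p X (S t)) * (\<integral>\<^sup>+ R. \<rho> X R * ennreal (g t (f R)) \<partial>\<pi>) \<partial>?L)"
    proof (intro nn_integral_cong)
      fix X assume X: "X \<in> space ?L"
      have "(\<integral>\<^sup>+ R. \<rho> X R * ennreal (likelihood n p X (S t) * g t (f R)) \<partial>\<pi>) =
        (\<integral>\<^sup>+ R. ennreal (likelihood n p X (S t)) * (\<rho> X R * ennreal (g t (f R))) \<partial>\<pi>)"
        using likelihood_pos[OF S[OF t]] g_nonneg[OF t]
        by (intro nn_integral_cong) (simp add: ennreal_mult less_imp_le mult_ac)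
      also have "\<dots> = ennreal (likelihood n p X (S t)) * (\<integral>\<^sup>+ R. \<rho> X R * ennreal (g t (f R)) \<partial>\<pi>)"
        using X by (intro nn_integral_cmult) measurable
      finally show "(\<integral>\<^sup>+ R. \<rho> X R * ennreal (likelihood n p X (S t) * g t (f R)) \<partial>\<pi>) = \<dots>" .
    qed
    also have "\<dots> = (\<integral>\<^sup>+ X. (\<integral>\<^sup>+ R. \<rho> X R * ennreal (g t (f R)) \<partial>\<pi>) \<partial>sample_dist n p (S t))"
      unfolding sample_dist_eq_density[OF S[OF t]] by (rule nn_integral_density[symmetric]) measurable
    also have "\<dots> = (\<integral>\<^sup>+ X. (\<integral>\<^sup>+ R. ennreal (g t (f R)) \<partial>posterior n p \<pi> X) \<partial>sample_dist n p (S t))"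
      by (intro nn_integral_cong post[symmetric]) (simp add: sample_dist_eq_density[OF S[OF t]])
    also have "\<dots> \<le> pp_risk n p \<pi> f (S t)"
      unfolding pp_risk_def using g_le[OF t] fS
      by (intro nn_integral_mono ennreal_leI) (simp add: posterior_def)
    finally show ?thesis .
  qed
  have "(\<integral>\<^sup>+ X. ennreal (m X) \<partial>?L) = (\<integral>\<^sup>+ X. ennreal (m X) * (\<integral>\<^sup>+ R. \<rho> X R \<partial>\<pi>) \<partial>?L)"
  proof (rule nn_integral_cong_AE)
    show "AE X in ?L. ennreal (m X) = ennreal (m X) * (\<integral>\<^sup>+ R. \<rho> X R \<partial>\<pi>)"
      using AE_posterior_density_normalised[OF prior, of n] unfolding \<rho>_def[symmetric]
      by eventually_elim simp
  qed
  also have "\<dots> = (\<integral>\<^sup>+ X. \<integral>\<^sup>+ R. ennreal (m X) * \<rho> X R \<partial>\<pi> \<partial>?L)"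
    by (intro nn_integral_cong nn_integral_cmult[symmetric]) measurable
  also have "\<dots> \<le> (\<integral>\<^sup>+ X. \<integral>\<^sup>+ R. (\<Sum>t\<in>T. ennreal (w t) * (\<rho> X R * ennreal (likelihood n p X (S t) * g t (f R)))) \<partial>\<pi> \<partial>?L)"
  proof (intro nn_integral_mono)
    fix X R assume R: "R \<in> space \<pi>"
    have "ennreal (m X) \<le> ennreal (\<Sum>t\<in>T. w t * likelihood n p X (S t) * g t (f R))"
      by (intro ennreal_leI m_le fS R)
    also have "\<dots> = (\<Sum>t\<in>T. ennreal (w t * likelihood n p X (S t) * g t (f R)))"
      using w g_nonneg likelihood_pos[OF S] by (intro sum_ennreal[symmetric]) (simp add: less_imp_le)
    also have "\<dots> = (\<Sum>t\<in>T. ennreal (w t) * ennreal (likelihood n p X (S t) * g t (f R)))"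
      using w g_nonneg likelihood_pos[OF S]
      by (intro sum.cong refl) (simp add: ennreal_mult[symmetric] less_imp_le mult.assoc)
    finally have "ennreal (m X) * \<rho> X R \<le> (\<Sum>t\<in>T. ennreal (w t) * ennreal (likelihood n p X (S t) * g t (f R))) * \<rho> X R"
      by (rule mult_right_mono) simp
    then show "ennreal (m X) * \<rho> X R \<le> (\<Sum>t\<in>T. ennreal (w t) * (\<rho> X R * ennreal (likelihood n p X (S t) * g t (f R))))"
      unfolding sum_distrib_right by (simp add: mult_ac)
  qed
  also have "\<dots> = (\<Sum>t\<in>T. ennreal (w t) * (\<integral>\<^sup>+ X. \<integral>\<^sup>+ R. \<rho> X R * ennreal (likelihood n p X (S t) * g t (f R)) \<partial>\<pi> \<partial>?L))"
  proof -
    have meas [measurable]: "(\<lambda>(X, R). \<rho> X R * ennreal (likelihood n p X (S t) * g t (f R))) \<in> borel_measurable (?L \<Otimes>\<^sub>M \<pi>)"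
      if t: "t \<in> T" for t
    proof -
      note [measurable] = gf[OF t]
      have [measurable]: "(\<lambda>X. likelihood n p X (S t)) \<in> borel_measurable ?L" using S[OF t] by simp
      show ?thesis by measurable
    qed
    have "(\<integral>\<^sup>+ X. \<integral>\<^sup>+ R. (\<Sum>t\<in>T. ennreal (w t) * (\<rho> X R * ennreal (likelihood n p X (S t) * g t (f R)))) \<partial>\<pi> \<partial>?L) =
      (\<integral>\<^sup>+ X. (\<Sum>t\<in>T. ennreal (w t) * (\<integral>\<^sup>+ R. \<rho> X R * ennreal (likelihood n p X (S t) * g t (f R)) \<partial>\<pi>)) \<partial>?L)"
    proof (intro nn_integral_cong)
      fix X assume X: "X \<in> space ?L"
      have [measurable]: "(\<lambda>R. \<rho> X R * ennreal (likelihood n p X (S t) * g t (f R))) \<in> borel_measurable \<pi>" if "t \<in> T" for t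
        using measurable_compose[OF measurable_Pair1'[OF X] meas[OF that]] by simp
      show "(\<integral>\<^sup>+ R. (\<Sum>t\<in>T. ennreal (w t) * (\<rho> X R * ennreal (likelihood n p X (S t) * g t (f R)))) \<partial>\<pi>) =
        (\<Sum>t\<in>T. ennreal (w t) * (\<integral>\<^sup>+ R. \<rho> X R * ennreal (likelihood n p X (S t) * g t (f R)) \<partial>\<pi>))"
        by (subst nn_integral_sum) (auto intro!: sum.cong nn_integral_cmult)
    qed
    also have "\<dots> = (\<Sum>t\<in>T. ennreal (w t) * (\<integral>\<^sup>+ X. \<integral>\<^sup>+ R. \<rho> X R * ennreal (likelihood n p X (S t) * g t (f R)) \<partial>\<pi> \<partial>?L))"
    proof -
      have [measurable]: "(\<lambda>X. \<integral>\<^sup>+ R. \<rho> X R * ennreal (likelihood n p X (S t) * g t (f R)) \<partial>\<pi>) \<in> borel_measurable ?L"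
        if "t \<in> T" for t using borel_measurable_nn_integral[OF meas[OF that]] by simp
      show ?thesis by (subst nn_integral_sum) (auto intro!: sum.cong nn_integral_cmult)
    qed
    finally show ?thesis .
  qed
  also have "\<dots> \<le> (\<Sum>t\<in>T. ennreal (w t) * pp_risk n p \<pi> f (S t))"
    by (intro sum_mono mult_left_mono risk) auto
  finally show ?thesis .
qed

lemma sup_risk_ge_average:
  assumes proc: "(\<pi>, f) \<in> pp_procedures p" and T: "finite T"
    and S: "\<And>t. t \<in> T \<Longrightarrow> S t \<in> banded_cov p k M0 M1"
    and w: "\<And>t. t \<in> T \<Longrightarrow> 0 \<le> w t" and w1: "(\<Sum>t\<in>T. w t) = 1"
    and le: "c \<le> (\<Sum>t\<in>T. ennreal (w t) * pp_risk n p \<pi> f (S t))"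
  shows "c \<le> (SUP S0 \<in> banded_cov p k M0 M1. pp_risk n p \<pi> f S0)"
proof -
  let ?s = "SUP S0 \<in> banded_cov p k M0 M1. pp_risk n p \<pi> f S0"
  have "c \<le> (\<Sum>t\<in>T. ennreal (w t) * ?s)"
    by (intro order_trans[OF le] sum_mono mult_left_mono SUP_upper S) auto
  also have "\<dots> = ennreal (\<Sum>t\<in>T. w t) * ?s"
    using w by (simp add: sum_distrib_right[symmetric] sum_ennreal)
  finally show ?thesis by (simp add: w1)
qed

text \<open>
  If \<open>P\<close> is a probability density as well, the integral of \<open>min P Q\<close> is one minus the total variation
  distance of the two. It is controlled by the second moment of \<open>Q / P\<close>, because \<open>min P Q \<ge> Q - Q\<^sup>2 / (4 P)\<close>: this is trivial for \<open>Q \<le> P\<close>, and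
  otherwise it says \<open>(Q / 2 - P)\<^sup>2 \<ge> 0\<close>.
\<close>

lemma affinity_ge_half:
  assumes [measurable]: "P \<in> borel_measurable M" "Q \<in> borel_measurable M"
    and pos: "\<And>x. P x > 0" "\<And>x. Q x \<ge> 0"
    and Q: "(\<integral>\<^sup>+ x. ennreal (Q x) \<partial>M) = 1"
    and chi: "(\<integral>\<^sup>+ x. ennreal ((Q x)\<^sup>2 / P x) \<partial>M) \<le> 2"
  shows "(\<integral>\<^sup>+ x. ennreal (min (P x) (Q x)) \<partial>M) \<ge> ennreal (1 / 2)"
proof -
  have pw: "Q x \<le> min (P x) (Q x) + (1/4) * ((Q x)\<^sup>2 / P x)" for x
  proof (cases "Q x \<le> P x")
    case False
    have "0 \<le> (Q x / 2 - P x)\<^sup>2" by simp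
    then have "Q x * P x \<le> P x * P x + (1/4) * (Q x)\<^sup>2" by (simp add: power2_eq_square algebra_simps)
    then have "Q x \<le> P x + (1/4) * ((Q x)\<^sup>2 / P x)" using pos(1)[of x] by (simp add: field_simps)
    then show ?thesis using False by simp
  qed (use pos[of x] in simp)
  have "1 = (\<integral>\<^sup>+ x. ennreal (Q x) \<partial>M)" using Q by simp
  also have "\<dots> \<le> (\<integral>\<^sup>+ x. ennreal (min (P x) (Q x)) + ennreal (1/4) * ennreal ((Q x)\<^sup>2 / P x) \<partial>M)"
    using pw pos by (intro nn_integral_mono)
      (simp add: ennreal_mult[symmetric] ennreal_plus[symmetric] less_imp_le del: ennreal_plus)
  also have "\<dots> = (\<integral>\<^sup>+ x. ennreal (min (P x) (Q x)) \<partial>M) + ennreal (1/4) * (\<integral>\<^sup>+ x. ennreal ((Q x)\<^sup>2 / P x) \<partial>M)"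
    by (simp add: nn_integral_add nn_integral_cmult)
  also have "\<dots> \<le> (\<integral>\<^sup>+ x. ennreal (min (P x) (Q x)) \<partial>M) + ennreal (1/4) * 2"
    by (intro add_left_mono mult_left_mono chi) auto
  also have "ennreal (1/4) * 2 = ennreal (1/2)"
    by (simp add: ennreal_mult[symmetric] flip: ennreal_numeral)
  finally have le: "1 \<le> (\<integral>\<^sup>+ x. ennreal (min (P x) (Q x)) \<partial>M) + ennreal (1/2)" .
  show ?thesis
  proof (cases "(\<integral>\<^sup>+ x. ennreal (min (P x) (Q x)) \<partial>M)")
    case (real r)
    have "ennreal 1 \<le> ennreal (r + 1/2)"
      using le real(1) unfolding real(2) by (simp only: ennreal_plus ennreal_1)
    then have "1 \<le> r + 1/2" using real(1) by (subst (asm) ennreal_le_iff) auto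
    then show ?thesis unfolding real(2) by (intro ennreal_leI) simp
  qed simp
qed

section \<open>Normal distributions in regression form\<close>

lemma lessThan_insert_0: "p \<ge> 1 \<Longrightarrow> {..<p} = insert 0 {1..<p}" for p :: nat
  by auto

text \<open>
  The covariance matrix of \<open>x\<close> when \<open>x\<^sub>1, \<dots>, x\<^bsub>p-1\<^esub>\<close> are independent centred normal variables with
  variances \<open>d\<^sub>i\<close> and \<open>x\<^sub>0 = \<Sum>\<^sub>i \<beta>\<^sub>i x\<^sub>i + \<epsilon>\<close>, where \<open>\<epsilon>\<close> is an independent normal variable with variance \<open>d\<^sub>0\<close>.
\<close>

definition regression_cov :: "nat \<Rightarrow> (nat \<Rightarrow> real) \<Rightarrow> (nat \<Rightarrow> real) \<Rightarrow> real mat" where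
  "regression_cov p \<beta> d = mat p p (\<lambda>(i, j).
     if i = 0 \<and> j = 0 then d 0 + (\<Sum>l\<in>{1..<p}. (\<beta> l)\<^sup>2 * d l)
     else if i = 0 then \<beta> j * d j
     else if j = 0 then \<beta> i * d i
     else if i = j then d i else 0)"

lemma regression_cov_carrier [simp]: "regression_cov p \<beta> d \<in> carrier_mat p p"
  by (simp add: regression_cov_def)

lemma regression_cov_sym:
  "i < p \<Longrightarrow> j < p \<Longrightarrow> regression_cov p \<beta> d $$ (i, j) = regression_cov p \<beta> d $$ (j, i)"
  by (simp add: regression_cov_def)

lemma quad_form_regression_cov:
  assumes p: "p \<ge> 1"
  shows "quad_form p (regression_cov p \<beta> d) v = d 0 * (v 0)\<^sup>2 + (\<Sum>i\<in>{1..<p}. d i * (v i + \<beta> i * v 0)\<^sup>2)"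
proof -
  let ?I = "{1..<p}" and ?S = "regression_cov p \<beta> d"
  have row: "(\<Sum>j\<in>?I. ?S $$ (i, j) * v i * v j) = d i * (v i)\<^sup>2" if "i \<in> ?I" for i
  proof -
    have "(\<Sum>j\<in>?I. ?S $$ (i, j) * v i * v j) = (\<Sum>j\<in>?I. if j = i then d i * (v i)\<^sup>2 else 0)"
      using that by (intro sum.cong) (auto simp: regression_cov_def power2_eq_square)
    then show ?thesis using that by (simp add: sum.delta)
  qed
  have "quad_form p ?S v = ?S $$ (0, 0) * v 0 * v 0 + (\<Sum>j\<in>?I. ?S $$ (0, j) * v 0 * v j) +
     (\<Sum>i\<in>?I. ?S $$ (i, 0) * v i * v 0 + (\<Sum>j\<in>?I. ?S $$ (i, j) * v i * v j))"
    by (simp add: quad_form_def lessThan_insert_0[OF p])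
  also have "\<dots> = (d 0 + (\<Sum>l\<in>?I. (\<beta> l)\<^sup>2 * d l)) * v 0 * v 0 + (\<Sum>j\<in>?I. \<beta> j * d j * v 0 * v j) +
     (\<Sum>i\<in>?I. \<beta> i * d i * v i * v 0 + d i * (v i)\<^sup>2)"
    using p row by (intro arg_cong2[of _ _ _ _ "(+)"] sum.cong) (auto simp: regression_cov_def)
  also have "\<dots> = d 0 * (v 0)\<^sup>2 + (\<Sum>i\<in>?I. (\<beta> i)\<^sup>2 * d i * v 0 * v 0 + \<beta> i * d i * v 0 * v i +
       (\<beta> i * d i * v i * v 0 + d i * (v i)\<^sup>2))"
  proof -
    have "(\<Sum>l\<in>?I. (\<beta> l)\<^sup>2 * d l) * v 0 * v 0 = (\<Sum>i\<in>?I. (\<beta> i)\<^sup>2 * d i * v 0 * v 0)"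
      by (simp add: sum_distrib_right)
    then show ?thesis by (simp only: sum.distrib) (simp add: algebra_simps power2_eq_square)
  qed
  also have "\<dots> = d 0 * (v 0)\<^sup>2 + (\<Sum>i\<in>?I. d i * (v i + \<beta> i * v 0)\<^sup>2)"
    by (intro arg_cong2[of _ _ _ _ "(+)"] sum.cong) (auto simp: power2_eq_square algebra_simps)
  finally show ?thesis .
qed

lemma regression_cov_pos_def:
  assumes p: "p \<ge> 1" and d: "\<And>i. i < p \<Longrightarrow> d i > 0"
  shows "regression_cov p \<beta> d \<in> pos_def_mats p"
  unfolding pos_def_mats_iff
proof (intro conjI allI impI)
  fix v :: "nat \<Rightarrow> real" assume v: "\<exists>i<p. v i \<noteq> 0"
  have nonneg: "\<And>i. i \<in> {1..<p} \<Longrightarrow> 0 \<le> d i * (v i + \<beta> i * v 0)\<^sup>2" using d by (simp add: less_imp_le)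
  have "d 0 * (v 0)\<^sup>2 + (\<Sum>i\<in>{1..<p}. d i * (v i + \<beta> i * v 0)\<^sup>2) > 0"
  proof (cases "v 0 = 0")
    case True
    with v obtain i where i: "i \<in> {1..<p}" "v i \<noteq> 0" by (metis atLeastLessThan_iff less_one not_le)
    then have "0 < d i * (v i + \<beta> i * v 0)\<^sup>2" using True d by simp
    then have "0 < (\<Sum>i\<in>{1..<p}. d i * (v i + \<beta> i * v 0)\<^sup>2)"
      using nonneg i(1) by (intro sum_pos2[of _ i]) auto
    then show ?thesis using True by simp
  next
    case False
    then have "d 0 * (v 0)\<^sup>2 > 0" using d p by simp
    then show ?thesis by (intro add_pos_nonneg sum_nonneg nonneg)
  qed
  then show "quad_form p (regression_cov p \<beta> d) v > 0" by (simp only: quad_form_regression_cov[OF p])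
qed (auto simp: regression_cov_sym)

definition regression_density :: "nat \<Rightarrow> (nat \<Rightarrow> real) \<Rightarrow> (nat \<Rightarrow> real) \<Rightarrow> (nat \<Rightarrow> real) \<Rightarrow> real" where
  "regression_density p \<beta> d x = normal_density (\<Sum>i\<in>{1..<p}. \<beta> i * x i) (sqrt (d 0)) (x 0) *
     (\<Prod>i\<in>{1..<p}. normal_density 0 (sqrt (d i)) (x i))"

text \<open>
  The response \<open>x\<^sub>0\<close> is integrated first, since its conditional law given the regressors is normal.
\<close>

lemma nn_integral_lebesgue_vec_split:
  assumes p: "p \<ge> 1" and f: "f \<in> borel_measurable (lebesgue_vec p)"
  shows "(\<integral>\<^sup>+ x. f x \<partial>lebesgue_vec p) = (\<integral>\<^sup>+ x. (\<integral>\<^sup>+ t. f (x(0 := t)) \<partial>lborel) \<partial>PiM {1..<p} (\<lambda>_. lborel))"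
  using f unfolding lessThan_insert_0[OF p] by (intro lborel_product.product_nn_integral_insert) auto

lemma measurable_sum_coeff [measurable]:
  "I \<subseteq> J \<Longrightarrow> (\<lambda>x. \<Sum>i\<in>I. \<beta> i * x i) \<in> borel_measurable (PiM J (\<lambda>_. lborel :: real measure))"
  by (intro borel_measurable_sum borel_measurable_times borel_measurable_const) (auto simp: subset_iff)

lemma measurable_prod_coord:
  assumes "I \<subseteq> J" and "\<And>i. i \<in> I \<Longrightarrow> h i \<in> borel_measurable lborel"
  shows "(\<lambda>x. \<Prod>i\<in>I. h i (x i) :: real) \<in> borel_measurable (PiM J (\<lambda>_. lborel :: real measure))"
  using assms by (intro borel_measurable_prod) (auto simp: subset_iff intro!: measurable_compose[OF measurable_component_singleton])

lemma normal_density_measurable_shift [measurable (raw)]: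
  assumes [measurable]: "f \<in> borel_measurable N" "g \<in> borel_measurable N"
  shows "(\<lambda>z. normal_density (f z) s (g z)) \<in> borel_measurable N"
  unfolding normal_density_def by measurable

lemma measurable_regression_density [measurable]:
  assumes p: "p \<ge> 1"
  shows "regression_density p \<beta> d \<in> borel_measurable (lebesgue_vec p)"
proof -
  have [measurable]: "(\<lambda>x. x 0) \<in> borel_measurable (lebesgue_vec p)"
    using p by (intro measurable_component_singleton[THEN measurable_compose]) auto
  have [measurable]: "(\<lambda>x. \<Prod>i\<in>{1..<p}. normal_density 0 (sqrt (d i)) (x i)) \<in> borel_measurable (lebesgue_vec p)"
    by (intro measurable_prod_coord) auto
  have [measurable]: "(\<lambda>x. \<Sum>i\<in>{1..<p}. \<beta> i * x i) \<in> borel_measurable (lebesgue_vec p)"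
    by (intro measurable_sum_coeff) auto
  show ?thesis unfolding regression_density_def by measurable
qed

lemma regression_density_fun_upd:
  "regression_density p \<beta> d (x(0 := t)) = normal_density (\<Sum>i\<in>{1..<p}. \<beta> i * x i) (sqrt (d 0)) t *
     (\<Prod>i\<in>{1..<p}. normal_density 0 (sqrt (d i)) (x i))"
proof -
  have "(\<Sum>i\<in>{1..<p}. \<beta> i * (x(0 := t)) i) = (\<Sum>i\<in>{1..<p}. \<beta> i * x i)"
    by (intro sum.cong) auto
  moreover have "(\<Prod>i\<in>{1..<p}. normal_density 0 (sqrt (d i)) ((x(0 := t)) i)) =
      (\<Prod>i\<in>{1..<p}. normal_density 0 (sqrt (d i)) (x i))"
    by (intro prod.cong) auto
  ultimately show ?thesis by (simp add: regression_density_def del: fun_upd_apply) simp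
qed

lemma nn_integral_prod_normal_weight:
  fixes I :: "nat set"
  assumes m: "m \<in> I" and I: "finite I" and d: "\<And>i. i \<in> I \<Longrightarrow> d i > 0" and w [measurable]: "w \<in> borel_measurable borel"
  shows "(\<integral>\<^sup>+ x. ennreal (\<Prod>i\<in>I. normal_density 0 (sqrt (d i)) (x i)) * w (x m) \<partial>PiM I (\<lambda>_. lborel)) =
    (\<integral>\<^sup>+ t. ennreal (normal_density 0 (sqrt (d m)) t) * w t \<partial>lborel)"
proof -
  define h where "h i t = ennreal (normal_density 0 (sqrt (d i)) t) * (if i = m then w t else 1)" for i t
  have [measurable]: "h i \<in> borel_measurable borel" for i unfolding h_def by measurable
  have "(\<integral>\<^sup>+ x. ennreal (\<Prod>i\<in>I. normal_density 0 (sqrt (d i)) (x i)) * w (x m) \<partial>PiM I (\<lambda>_. lborel)) =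
    (\<integral>\<^sup>+ x. (\<Prod>i\<in>I. h i (x i)) \<partial>PiM I (\<lambda>_. lborel))"
    using m I by (intro nn_integral_cong) (simp add: h_def prod.distrib prod.delta prod_ennreal)
  also have "\<dots> = (\<Prod>i\<in>I. \<integral>\<^sup>+ t. h i t \<partial>lborel)"
    by (rule lborel_product.product_nn_integral_prod) (use I in auto)
  also have "\<dots> = (\<Prod>i\<in>I. if i = m then \<integral>\<^sup>+ t. ennreal (normal_density 0 (sqrt (d m)) t) * w t \<partial>lborel else 1)"
    using d by (intro prod.cong) (auto simp: h_def nn_integral_normal_density)
  also have "\<dots> = (\<integral>\<^sup>+ t. ennreal (normal_density 0 (sqrt (d m)) t) * w t \<partial>lborel)"
    using m I by (simp add: prod.delta)
  finally show ?thesis .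
qed

lemma nn_integral_prod_normal:
  fixes I :: "nat set"
  assumes I: "finite I" and d: "\<And>i. i \<in> I \<Longrightarrow> d i > 0"
  shows "(\<integral>\<^sup>+ x. ennreal (\<Prod>i\<in>I. normal_density 0 (sqrt (d i)) (x i)) \<partial>PiM I (\<lambda>_. lborel)) = 1"
proof -
  have "(\<integral>\<^sup>+ x. ennreal (\<Prod>i\<in>I. normal_density 0 (sqrt (d i)) (x i)) \<partial>PiM I (\<lambda>_. lborel)) =
    (\<integral>\<^sup>+ x. (\<Prod>i\<in>I. ennreal (normal_density 0 (sqrt (d i)) (x i))) \<partial>PiM I (\<lambda>_. lborel))"
    by (simp add: prod_ennreal)
  also have "\<dots> = (\<Prod>i\<in>I. \<integral>\<^sup>+ t. ennreal (normal_density 0 (sqrt (d i)) t) \<partial>lborel)"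
    by (rule lborel_product.product_nn_integral_prod) (use I in auto)
  also have "\<dots> = 1" using d by (simp add: nn_integral_normal_density)
  finally show ?thesis .
qed

lemma nn_integral_regression_density:
  assumes p: "p \<ge> 1" and d: "\<And>i. i < p \<Longrightarrow> d i > 0"
  shows "(\<integral>\<^sup>+ x. ennreal (regression_density p \<beta> d x) \<partial>lebesgue_vec p) = 1"
proof -
  have "(\<integral>\<^sup>+ x. ennreal (regression_density p \<beta> d x) \<partial>lebesgue_vec p) =
    (\<integral>\<^sup>+ x. \<integral>\<^sup>+ t. ennreal (normal_density (\<Sum>i\<in>{1..<p}. \<beta> i * x i) (sqrt (d 0)) t) *
     ennreal (\<Prod>i\<in>{1..<p}. normal_density 0 (sqrt (d i)) (x i)) \<partial>lborel \<partial>PiM {1..<p} (\<lambda>_. lborel))"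
    using p by (simp add: nn_integral_lebesgue_vec_split regression_density_fun_upd ennreal_mult prod_nonneg)
  also have "\<dots> = (\<integral>\<^sup>+ x. ennreal (\<Prod>i\<in>{1..<p}. normal_density 0 (sqrt (d i)) (x i)) \<partial>PiM {1..<p} (\<lambda>_. lborel))"
    using d p by (simp add: nn_integral_multc nn_integral_normal_density)
  also have "\<dots> = 1" using d by (intro nn_integral_prod_normal) auto
  finally show ?thesis .
qed

text \<open>
  The exponents agree because \<open>S y = x\<close> has the explicit solution \<open>y\<close> below. The determinant need not
  be computed: both functions integrate to one and are proportional, hence equal.
\<close>

lemma mvn_density_regression_cov:
  assumes p: "p \<ge> 1" and d: "\<And>i. i < p \<Longrightarrow> d i > 0"
  shows "mvn_density p (regression_cov p \<beta> d) x = regression_density p \<beta> d x"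
proof -
  let ?S = "regression_cov p \<beta> d" and ?I = "{1..<p}"
  have S: "?S \<in> pos_def_mats p" by (rule regression_cov_pos_def[OF p d])
  define c where "c = sqrt ((2 * pi) ^ p * Determinant.det ?S)"
  define c' where "c' = sqrt (2 * pi * d 0) * (\<Prod>i\<in>?I. sqrt (2 * pi * d i))"
  have c: "c > 0" unfolding c_def using det_pos_def[OF S] by simp
  have c': "c' > 0" unfolding c'_def using d p by (intro mult_pos_pos prod_pos) auto
  define q where "q x = (x 0 - (\<Sum>i\<in>?I. \<beta> i * x i))\<^sup>2 / d 0 + (\<Sum>i\<in>?I. (x i)\<^sup>2 / d i)" for x :: "nat \<Rightarrow> real"
  have mvn: "mvn_density p ?S x = exp (- q x / 2) / c" for x
  proof -
    define w where "w = (x 0 - (\<Sum>i\<in>?I. \<beta> i * x i)) / d 0"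
    define y where "y i = (if i = 0 then w else x i / d i - \<beta> i * w)" for i
    have d0: "d 0 > 0" using d p by simp
    have dne: "d i \<noteq> 0" if "i \<in> ?I" for i using d[of i] that by auto
    have Sy: "?S *\<^sub>v vec p y = vec p x"
    proof (rule eq_vecI)
      fix i assume "i < dim_vec (vec p x)"
      then have i: "i < p" by simp
      have "vec_index (?S *\<^sub>v vec p y) i = ?S $$ (i, 0) * y 0 + (\<Sum>j\<in>?I. ?S $$ (i, j) * y j)"
        by (simp add: mult_mat_vec_entry[OF regression_cov_carrier i] lessThan_insert_0[OF p])
      also have "\<dots> = x i"
      proof (cases "i = 0")
        case True
        have "(\<Sum>j\<in>?I. ?S $$ (i, j) * y j) = (\<Sum>j\<in>?I. \<beta> j * x j - (\<beta> j)\<^sup>2 * d j * w)"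
          using True dne p by (intro sum.cong) (auto simp: regression_cov_def y_def power2_eq_square field_simps)
        also have "\<dots> = (\<Sum>j\<in>?I. \<beta> j * x j) - (\<Sum>j\<in>?I. (\<beta> j)\<^sup>2 * d j) * w"
          by (simp add: sum_subtractf sum_distrib_right)
        finally have "?S $$ (i, 0) * y 0 + (\<Sum>j\<in>?I. ?S $$ (i, j) * y j) = d 0 * w + (\<Sum>j\<in>?I. \<beta> j * x j)"
          using True p by (simp add: regression_cov_def y_def algebra_simps)
        then show ?thesis using d0 True by (simp add: w_def)
      next
        case False
        then have iI: "i \<in> ?I" using i by simp
        have "(\<Sum>j\<in>?I. ?S $$ (i, j) * y j) = (\<Sum>j\<in>?I. if j = i then d i * y i else 0)"
          using i False by (intro sum.cong) (auto simp: regression_cov_def)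
        also have "\<dots> = d i * y i" using iI by (simp add: sum.delta)
        finally have "?S $$ (i, 0) * y 0 + (\<Sum>j\<in>?I. ?S $$ (i, j) * y j) = \<beta> i * d i * w + d i * (x i / d i - \<beta> i * w)"
          using i False p by (simp add: regression_cov_def y_def)
        then show ?thesis using dne[OF iI] by (simp add: field_simps)
      qed
      finally show "vec_index (?S *\<^sub>v vec p y) i = vec_index (vec p x) i" using i by simp
    qed (simp add: regression_cov_def)
    obtain B where B: "the (mat_inverse ?S) = B" "B * ?S = 1\<^sub>m p" "B \<in> pos_def_mats p"
      using pos_def_inverse[OF S] by metis
    have "B *\<^sub>v vec p x = vec p y"
      using assoc_mult_mat_vec[of B p p ?S p "vec p y"] B Sy by (simp add: pos_def_mats_carrier)
    then have "mvn_density p ?S x = exp (- scalar_prod (vec p x) (vec p y) / 2) / c"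
      by (simp add: mvn_density_def B(1) c_def)
    moreover have "scalar_prod (vec p x) (vec p y) = q x"
    proof -
      have "scalar_prod (vec p x) (vec p y) = x 0 * y 0 + (\<Sum>i\<in>?I. x i * y i)"
        using p by (simp add: scalar_prod_def lessThan_atLeast0[symmetric] lessThan_insert_0[OF p])
      also have "(\<Sum>i\<in>?I. x i * y i) = (\<Sum>i\<in>?I. (x i)\<^sup>2 / d i - \<beta> i * x i * w)"
        by (intro sum.cong) (auto simp: y_def power2_eq_square algebra_simps)
      also have "\<dots> = (\<Sum>i\<in>?I. (x i)\<^sup>2 / d i) - (\<Sum>i\<in>?I. \<beta> i * x i) * w"
        by (simp add: sum_subtractf sum_distrib_right)
      also have "x 0 * y 0 + \<dots> = (x 0 - (\<Sum>i\<in>?I. \<beta> i * x i)) * w + (\<Sum>i\<in>?I. (x i)\<^sup>2 / d i)"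
        by (simp add: y_def algebra_simps)
      finally show ?thesis by (simp add: w_def q_def power2_eq_square)
    qed
    ultimately show ?thesis by simp
  qed
  have reg: "regression_density p \<beta> d x = exp (- q x / 2) / c'" for x
  proof -
    have "(\<Prod>i\<in>?I. normal_density 0 (sqrt (d i)) (x i)) = (\<Prod>i\<in>?I. exp (- ((x i)\<^sup>2 / d i) / 2) / sqrt (2 * pi * d i))"
      using d by (intro prod.cong) (auto simp: normal_density_def less_imp_le field_simps)
    also have "\<dots> = exp (- (\<Sum>i\<in>?I. (x i)\<^sup>2 / d i) / 2) / (\<Prod>i\<in>?I. sqrt (2 * pi * d i))"
      by (simp add: prod_dividef exp_sum[symmetric] sum_negf sum_divide_distrib)
    finally have "regression_density p \<beta> d x = (exp (- ((x 0 - (\<Sum>i\<in>?I. \<beta> i * x i))\<^sup>2 / d 0) / 2) / sqrt (2 * pi * d 0)) *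
        (exp (- (\<Sum>i\<in>?I. (x i)\<^sup>2 / d i) / 2) / (\<Prod>i\<in>?I. sqrt (2 * pi * d i)))"
      using d[of 0] p by (simp add: regression_density_def normal_density_def less_imp_le field_simps)
    also have "\<dots> = exp (- ((x 0 - (\<Sum>i\<in>?I. \<beta> i * x i))\<^sup>2 / d 0) / 2 + - (\<Sum>i\<in>?I. (x i)\<^sup>2 / d i) / 2) / c'"
      unfolding exp_add c'_def by simp
    also have "- ((x 0 - (\<Sum>i\<in>?I. \<beta> i * x i))\<^sup>2 / d 0) / 2 + - (\<Sum>i\<in>?I. (x i)\<^sup>2 / d i) / 2 = - q x / 2"
      by (simp add: q_def field_simps)
    finally show ?thesis .
  qed
  have "1 = (\<integral>\<^sup>+ x. ennreal (regression_density p \<beta> d x) \<partial>lebesgue_vec p)"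
    using nn_integral_regression_density[OF p d] by simp
  also have "\<dots> = (\<integral>\<^sup>+ x. ennreal (c / c') * ennreal (mvn_density p ?S x) \<partial>lebesgue_vec p)"
    unfolding reg mvn using c c' by (intro nn_integral_cong) (simp add: ennreal_mult[symmetric])
  also have "\<dots> = ennreal (c / c')"
    using S by (simp add: nn_integral_cmult nn_integral_mvn_density)
  finally have "c / c' = 1" using c c' by (metis divide_nonneg_nonneg ennreal_eq_1 less_imp_le)
  then have "c = c'" using c' by simp
  then show ?thesis by (simp add: reg mvn)
qed

text \<open>
  For normal densities of equal variance, completing the square turns \<open>q\<^sup>2 / p\<close> into a multiple of the
  density whose mean is reflected, \<open>2m' - m\<close>. The factor is the second moment of \<open>q / p\<close>.
\<close>

lemma normal_density_square_ratio:
  assumes "s > 0"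
  shows "normal_density m' s t * normal_density m' s t / normal_density m s t =
    exp ((m' - m)\<^sup>2 / s\<^sup>2) * normal_density (2 * m' - m) s t"
proof -
  define r where "r = sqrt (2 * pi * s\<^sup>2)"
  have r: "r > 0" using assms by (simp add: r_def)
  have "exp (-(t - m')\<^sup>2 / (2 * s\<^sup>2)) * exp (-(t - m')\<^sup>2 / (2 * s\<^sup>2)) / exp (-(t - m)\<^sup>2 / (2 * s\<^sup>2)) =
     exp (-(t - m')\<^sup>2 / (2 * s\<^sup>2) + -(t - m')\<^sup>2 / (2 * s\<^sup>2) - -(t - m)\<^sup>2 / (2 * s\<^sup>2))"
    by (simp only: exp_add exp_diff)
  also have "-(t - m')\<^sup>2 / (2 * s\<^sup>2) + -(t - m')\<^sup>2 / (2 * s\<^sup>2) - -(t - m)\<^sup>2 / (2 * s\<^sup>2) =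
     (m' - m)\<^sup>2 / s\<^sup>2 + -(t - (2 * m' - m))\<^sup>2 / (2 * s\<^sup>2)"
    using assms by (simp add: field_simps power2_eq_square)
  finally have e: "exp (-(t - m')\<^sup>2 / (2 * s\<^sup>2)) * exp (-(t - m')\<^sup>2 / (2 * s\<^sup>2)) / exp (-(t - m)\<^sup>2 / (2 * s\<^sup>2)) =
     exp ((m' - m)\<^sup>2 / s\<^sup>2) * exp (-(t - (2 * m' - m))\<^sup>2 / (2 * s\<^sup>2))" by (simp only: exp_add)
  show ?thesis
    unfolding normal_density_def r_def[symmetric] using e r by (simp add: field_simps)
qed

lemma nn_integral_normal_density_exp_square:
  assumes v: "v > 0" and c: "2 * c * v < 1"
  shows "(\<integral>\<^sup>+ t. ennreal (normal_density 0 (sqrt v) t) * ennreal (exp (c * t\<^sup>2)) \<partial>lborel) =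
    ennreal (1 / sqrt (1 - 2 * c * v))"
proof -
  define u where "u = 1 - 2 * c * v"
  have u: "u > 0" using c by (simp add: u_def)
  have "ennreal (normal_density 0 (sqrt v) t) * ennreal (exp (c * t\<^sup>2)) =
    ennreal (1 / sqrt u) * ennreal (normal_density 0 (sqrt (v / u)) t)" for t
  proof -
    have "- (t\<^sup>2 / (2 * v)) + c * t\<^sup>2 = - (t\<^sup>2 * u / (2 * v))"
      using v by (simp add: u_def field_simps)
    then have "exp (- (t\<^sup>2 / (2 * v))) * exp (c * t\<^sup>2) = exp (- (t\<^sup>2 * u / (2 * v)))"
      by (simp only: exp_add[symmetric])
    then have "normal_density 0 (sqrt v) t * exp (c * t\<^sup>2) = 1 / sqrt u * normal_density 0 (sqrt (v / u)) t"
      using u v by (simp add: normal_density_def real_sqrt_divide real_sqrt_mult field_simps)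
    then show ?thesis using u by (simp add: ennreal_mult[symmetric])
  qed
  then show ?thesis using u v
    by (simp add: nn_integral_cmult nn_integral_normal_density u_def[symmetric])
qed

text \<open>
  Given the regressors, flipping the sign of \<open>\<beta>\<^sub>m\<close> shifts the mean of the response by \<open>2 \<beta>\<^sub>m x\<^sub>m\<close>. This
  contributes the factor \<open>exp (4 \<beta>\<^sub>m\<^sup>2 x\<^sub>m\<^sup>2 / d\<^sub>0)\<close>, whose expectation under \<open>x\<^sub>m \<sim> N(0, d\<^sub>m)\<close> is the right-hand side.
\<close>

lemma chi_square_sign_flip:
  assumes p: "p \<ge> 1" and d: "\<And>i. i < p \<Longrightarrow> d i > 0" and m: "m \<in> {1..<p}"
    and \<beta>': "\<beta>' m = - \<beta> m" "\<And>i. i \<noteq> m \<Longrightarrow> \<beta>' i = \<beta> i"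
    and small: "8 * (\<beta> m)\<^sup>2 * d m / d 0 < 1"
  shows "(\<integral>\<^sup>+ x. ennreal (regression_density p \<beta>' d x * regression_density p \<beta>' d x / regression_density p \<beta> d x) \<partial>lebesgue_vec p) =
    ennreal (1 / sqrt (1 - 8 * (\<beta> m)\<^sup>2 * d m / d 0))"
proof -
  let ?I = "{1..<p}"
  define \<mu> where "\<mu> x = (\<Sum>i\<in>?I. \<beta> i * x i)" for x :: "nat \<Rightarrow> real"
  define \<mu>' where "\<mu>' x = (\<Sum>i\<in>?I. \<beta>' i * x i)" for x :: "nat \<Rightarrow> real"
  define P where "P x = (\<Prod>i\<in>?I. normal_density 0 (sqrt (d i)) (x i))" for x
  have d0: "d 0 > 0" using p d by simp
  have P: "P x > 0" for x unfolding P_def using d by (intro prod_pos) (auto intro!: normal_density_pos)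
  have diff: "\<mu>' x - \<mu> x = - 2 * \<beta> m * x m" for x
  proof -
    have "\<mu>' x - \<mu> x = (\<Sum>i\<in>?I. if i = m then - 2 * \<beta> m * x m else 0)"
      unfolding \<mu>_def \<mu>'_def sum_subtractf[symmetric] using \<beta>' by (intro sum.cong) auto
    then show ?thesis using m by (simp add: sum.delta)
  qed
  define w where "w t = ennreal (exp (4 * (\<beta> m)\<^sup>2 / d 0 * t\<^sup>2))" for t
  have [measurable]: "w \<in> borel_measurable borel" unfolding w_def by measurable
  have ratio: "regression_density p \<beta>' d (x(0 := t)) * regression_density p \<beta>' d (x(0 := t)) / regression_density p \<beta> d (x(0 := t)) =
      (exp (4 * (\<beta> m)\<^sup>2 / d 0 * (x m)\<^sup>2) * P x) * normal_density (2 * \<mu>' x - \<mu> x) (sqrt (d 0)) t" for x t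
  proof -
    have "regression_density p \<beta>' d (x(0 := t)) * regression_density p \<beta>' d (x(0 := t)) / regression_density p \<beta> d (x(0 := t)) =
      (normal_density (\<mu>' x) (sqrt (d 0)) t * normal_density (\<mu>' x) (sqrt (d 0)) t / normal_density (\<mu> x) (sqrt (d 0)) t) * P x"
      unfolding regression_density_fun_upd P_def[symmetric] \<mu>_def[symmetric] \<mu>'_def[symmetric] using P[of x] by (simp add: field_simps)
    also have "\<dots> = exp ((\<mu>' x - \<mu> x)\<^sup>2 / d 0) * normal_density (2 * \<mu>' x - \<mu> x) (sqrt (d 0)) t * P x"
      using d0 by (simp add: normal_density_square_ratio)
    also have "(\<mu>' x - \<mu> x)\<^sup>2 / d 0 = 4 * (\<beta> m)\<^sup>2 / d 0 * (x m)\<^sup>2"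
      unfolding diff by (simp add: power_mult_distrib)
    finally show ?thesis by (simp only: mult_ac)
  qed
  have "(\<integral>\<^sup>+ x. ennreal (regression_density p \<beta>' d x * regression_density p \<beta>' d x / regression_density p \<beta> d x) \<partial>lebesgue_vec p) =
    (\<integral>\<^sup>+ x. \<integral>\<^sup>+ t. ennreal (exp (4 * (\<beta> m)\<^sup>2 / d 0 * (x m)\<^sup>2) * P x) * ennreal (normal_density (2 * \<mu>' x - \<mu> x) (sqrt (d 0)) t)
        \<partial>lborel \<partial>PiM ?I (\<lambda>_. lborel))"
    using p P by (subst nn_integral_lebesgue_vec_split) (simp_all add: ratio ennreal_mult less_imp_le del: fun_upd_apply)
  also have "\<dots> = (\<integral>\<^sup>+ x. ennreal (P x) * w (x m) \<partial>PiM ?I (\<lambda>_. lborel))"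
    using d0 P by (intro nn_integral_cong, subst nn_integral_cmult)
      (simp, simp add: nn_integral_normal_density w_def ennreal_mult less_imp_le mult.commute)
  also have "\<dots> = (\<integral>\<^sup>+ t. ennreal (normal_density 0 (sqrt (d m)) t) * w t \<partial>lborel)"
    unfolding P_def using m d by (intro nn_integral_prod_normal_weight) auto
  also have "\<dots> = ennreal (1 / sqrt (1 - 2 * (4 * (\<beta> m)\<^sup>2 / d 0) * d m))"
    unfolding w_def using m d small by (intro nn_integral_normal_density_exp_square) auto
  finally show ?thesis by simp
qed

lemma regression_density_diag:
  assumes "p \<ge> 1"
  shows "regression_density p (\<lambda>_. 0) d x = (\<Prod>i<p. normal_density 0 (sqrt (d i)) (x i))"
  by (simp add: regression_density_def lessThan_insert_0[OF assms])

lemma chi_square_scale: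
  assumes a: "a > 0" and \<delta>: "0 < \<delta>" "\<delta> < 1"
  defines "b \<equiv> a * (1 + \<delta>)"
  shows "(\<integral>\<^sup>+ t. ennreal (normal_density 0 (sqrt b) t * normal_density 0 (sqrt b) t / normal_density 0 (sqrt a) t) \<partial>lborel) =
     ennreal (1 / sqrt (1 - \<delta>\<^sup>2))"
proof -
  have b: "b > 0" using a \<delta> by (simp add: b_def)
  define c where "c = \<delta> / (2 * b)"
  have "2 * c * b = \<delta>" using b by (simp add: c_def)
  have ratio: "normal_density 0 (sqrt b) t / normal_density 0 (sqrt a) t = 1 / sqrt (1 + \<delta>) * exp (c * t\<^sup>2)" for t
  proof -
    have ba: "b - a = a * \<delta>" by (simp add: b_def algebra_simps)
    have c': "c = (b - a) / (2 * a * b)" unfolding ba c_def using a by simp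
    have "- (t\<^sup>2 / (2 * b)) - - (t\<^sup>2 / (2 * a)) = c * t\<^sup>2"
      unfolding c' using a b by (simp add: field_simps)
    then have "exp (- (t\<^sup>2 / (2 * b))) / exp (- (t\<^sup>2 / (2 * a))) = exp (c * t\<^sup>2)"
      by (simp only: exp_diff[symmetric])
    moreover have "sqrt (2 * pi * b) = sqrt (2 * pi * a) * sqrt (1 + \<delta>)"
      by (simp add: b_def real_sqrt_mult)
    ultimately show ?thesis using a b \<delta> by (simp add: normal_density_def field_simps)
  qed
  have "normal_density 0 (sqrt b) t * normal_density 0 (sqrt b) t / normal_density 0 (sqrt a) t =
     1 / sqrt (1 + \<delta>) * (normal_density 0 (sqrt b) t * exp (c * t\<^sup>2))" for t
    using ratio[of t] by (simp add: mult.assoc[symmetric] flip: times_divide_eq_right)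
  then have "(\<integral>\<^sup>+ t. ennreal (normal_density 0 (sqrt b) t * normal_density 0 (sqrt b) t / normal_density 0 (sqrt a) t) \<partial>lborel) =
    (\<integral>\<^sup>+ t. ennreal (1 / sqrt (1 + \<delta>)) * (ennreal (normal_density 0 (sqrt b) t) * ennreal (exp (c * t\<^sup>2))) \<partial>lborel)"
    using \<delta> by (simp only: ennreal_mult'[symmetric] ennreal_mult''[symmetric]) (simp add: ennreal_mult[symmetric])
  also have "\<dots> = ennreal (1 / sqrt (1 + \<delta>)) * ennreal (1 / sqrt (1 - \<delta>))"
    using nn_integral_normal_density_exp_square[of b c] b \<delta> \<open>2 * c * b = \<delta>\<close> by (simp add: nn_integral_cmult)
  also have "\<dots> = ennreal (1 / sqrt (1 - \<delta>\<^sup>2))"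
  proof -
    have "sqrt (1 + \<delta>) * sqrt (1 - \<delta>) = sqrt (1 - \<delta>\<^sup>2)"
      by (simp add: real_sqrt_mult[symmetric] algebra_simps power2_eq_square)
    then show ?thesis using \<delta> by (simp add: ennreal_mult[symmetric])
  qed
  finally show ?thesis .
qed

text \<open>
  For two different bumped coordinates the two likelihood ratios are independent under the
  hypothesis without bump, so their product has expectation one; this is why a mixture over many
  coordinates is hard to detect.
\<close>

lemma chi_square_variance_bump:
  assumes p: "p \<ge> 1" and a: "a > 0" and \<delta>: "0 < \<delta>" "\<delta> < 1" and j: "j < p" and l: "l < p"
  defines "D \<equiv> \<lambda>j i. if i = j then a * (1 + \<delta>) else a"
  shows "(\<integral>\<^sup>+ x. ennreal (regression_density p (\<lambda>_. 0) (D j) x * regression_density p (\<lambda>_. 0) (D l) x /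
      regression_density p (\<lambda>_. 0) (\<lambda>_. a) x) \<partial>lebesgue_vec p) = (if j = l then ennreal (1 / sqrt (1 - \<delta>\<^sup>2)) else 1)"
proof -
  define h where "h i t = normal_density 0 (sqrt (D j i)) t * normal_density 0 (sqrt (D l i)) t / normal_density 0 (sqrt a) t" for i t
  have [measurable]: "h i \<in> borel_measurable borel" for i unfolding h_def by measurable
  have D: "D j i > 0" for j i using a \<delta> by (simp add: D_def)
  have h_nonneg: "h i t \<ge> 0" for i t unfolding h_def by simp
  have hi: "(\<integral>\<^sup>+ t. ennreal (h i t) \<partial>lborel) = (if i = j \<and> j = l then ennreal (1 / sqrt (1 - \<delta>\<^sup>2)) else 1)" for i
  proof (cases "i = j \<and> j = l")
    case True
    then show ?thesis using chi_square_scale[OF a \<delta>] by (simp add: h_def D_def)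
  next
    case False
    have pos: "normal_density 0 (sqrt a) t > 0" for t using a by (intro normal_density_pos) simp
    obtain b where "b > 0" "\<And>t. h i t = normal_density 0 (sqrt b) t"
    proof (cases "i = j")
      case True
      then have "D l i = a" using False by (auto simp: D_def)
      then have "h i t = normal_density 0 (sqrt (D j i)) t" for t using pos[of t] by (simp add: h_def)
      then show thesis using that D by blast
    next
      case False
      then have "D j i = a" by (auto simp: D_def)
      then have "h i t = normal_density 0 (sqrt (D l i)) t" for t using pos[of t] by (simp add: h_def)
      then show thesis using that D by blast
    qed
    then show ?thesis using False by (auto simp: nn_integral_normal_density)
  qed
  have "(\<integral>\<^sup>+ x. ennreal (regression_density p (\<lambda>_. 0) (D j) x * regression_density p (\<lambda>_. 0) (D l) x /
      regression_density p (\<lambda>_. 0) (\<lambda>_. a) x) \<partial>lebesgue_vec p) = (\<integral>\<^sup>+ x. (\<Prod>i<p. ennreal (h i (x i))) \<partial>lebesgue_vec p)"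
  proof (intro nn_integral_cong)
    fix x :: "nat \<Rightarrow> real"
    have "regression_density p (\<lambda>_. 0) (D j) x * regression_density p (\<lambda>_. 0) (D l) x /
      regression_density p (\<lambda>_. 0) (\<lambda>_. a) x = (\<Prod>i<p. h i (x i))"
      by (simp only: regression_density_diag[OF p] h_def prod_dividef prod.distrib)
    then show "ennreal (regression_density p (\<lambda>_. 0) (D j) x * regression_density p (\<lambda>_. 0) (D l) x /
      regression_density p (\<lambda>_. 0) (\<lambda>_. a) x) = (\<Prod>i<p. ennreal (h i (x i)))"
      by (simp add: prod_ennreal h_nonneg)
  qed
  also have "\<dots> = (\<Prod>i<p. \<integral>\<^sup>+ t. ennreal (h i t) \<partial>lborel)"
    by (rule lborel_product.product_nn_integral_prod) auto
  also have "\<dots> = (\<Prod>i<p. if i = j then (if j = l then ennreal (1 / sqrt (1 - \<delta>\<^sup>2)) else 1) else 1)"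
    unfolding hi by (intro prod.cong) auto
  also have "\<dots> = (if j = l then ennreal (1 / sqrt (1 - \<delta>\<^sup>2)) else 1)"
    using j by (simp add: prod.delta)
  finally show ?thesis .
qed

lemma nn_integral_likelihood_ratio:
  assumes S: "S \<in> pos_def_mats p" "S' \<in> pos_def_mats p" "S0 \<in> pos_def_mats p"
  shows "(\<integral>\<^sup>+ X. ennreal (likelihood n p X S * likelihood n p X S' / likelihood n p X S0) \<partial>lebesgue_sample n p) =
    (\<integral>\<^sup>+ x. ennreal (mvn_density p S x * mvn_density p S' x / mvn_density p S0 x) \<partial>lebesgue_vec p) ^ n"
proof -
  let ?h = "\<lambda>x. mvn_density p S x * mvn_density p S' x / mvn_density p S0 x"
  have nonneg: "?h x \<ge> 0" for x
    using mvn_density_pos[OF S(1)] mvn_density_pos[OF S(2)] mvn_density_pos[OF S(3)] by (simp add: less_imp_le)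
  have "ennreal (likelihood n p X S * likelihood n p X S' / likelihood n p X S0) = (\<Prod>i<n. ennreal (?h (X i)))" for X
  proof -
    have "likelihood n p X S * likelihood n p X S' / likelihood n p X S0 = (\<Prod>i<n. ?h (X i))"
      by (simp only: likelihood_def prod_dividef prod.distrib)
    then show ?thesis using nonneg by (simp only: prod_ennreal)
  qed
  moreover have "(\<lambda>x. ennreal (?h x)) \<in> borel_measurable (lebesgue_vec p)" using S by measurable
  ultimately show ?thesis
    using nn_integral_sample_prod[of "\<lambda>x. ennreal (?h x)" p n] by (simp only:)
qed

section \<open>The two lower bounds and the minimax rate\<close>

lemma measurable_mat_entry_diff_square [measurable]:
  "i < p \<Longrightarrow> j < p \<Longrightarrow> (\<lambda>A. (A $$ (i, j) - c)\<^sup>2) \<in> borel_measurable (mat_borel p)"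
  by (intro borel_measurable_power borel_measurable_diff measurable_mat_entry borel_measurable_const)

lemma sub_row_le_spectral_norm:
  assumes A: "A \<in> carrier_mat p p" and S: "S \<in> carrier_mat p p" and i: "i < p" and J: "J \<subseteq> {..<p}"
  shows "(\<Sum>j\<in>J. (A $$ (i, j) - S $$ (i, j))\<^sup>2) \<le> (spectral_norm (A - S))\<^sup>2"
proof -
  have AS: "A - S \<in> carrier_mat p p" using A S by auto
  have "(\<Sum>j\<in>J. (A $$ (i, j) - S $$ (i, j))\<^sup>2) \<le> (\<Sum>j<p. (A $$ (i, j) - S $$ (i, j))\<^sup>2)"
    using J by (intro sum_mono2) auto
  also have "\<dots> = (\<Sum>j<p. ((A - S) $$ (i, j))\<^sup>2)"
    using A S i by (intro sum.cong) auto
  also have "\<dots> \<le> (spectral_norm (A - S))\<^sup>2"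
    by (rule row_sum_squares_le_spectral_norm[OF AS i])
  finally show ?thesis .
qed

lemma sum_Pow_pair:
  fixes F :: "'a set \<Rightarrow> real"
  assumes J: "finite J" and i: "i \<in> J"
  shows "(\<Sum>\<theta>\<in>Pow J. F \<theta>) = (\<Sum>\<theta>\<in>Pow (J - {i}). F \<theta> + F (insert i \<theta>))"
proof -
  have "Pow J = Pow (J - {i}) \<union> insert i ` Pow (J - {i})"
    using Pow_insert[of i "J - {i}"] i by (simp add: insert_absorb)
  moreover have "Pow (J - {i}) \<inter> insert i ` Pow (J - {i}) = {}" by auto
  moreover have "inj_on (insert i) (Pow (J - {i}))" by (auto simp: inj_on_def)
  ultimately show ?thesis
    using J by (simp add: sum.union_disjoint sum.reindex sum.distrib)
qed

lemma inverse_sqrt_power_le_2: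
  assumes u: "0 \<le> u" "real n * u \<le> 3 / 4" "u < 1"
  shows "(1 / sqrt (1 - u)) ^ n \<le> 2"
proof -
  have "1 / 4 \<le> 1 + real n * (- u)" using u by simp
  also have "\<dots> \<le> (1 + - u) ^ n" using u by (intro Bernoulli_inequality) simp
  finally have "1 / 4 \<le> (1 - u) ^ n" by simp
  then have "sqrt (1 / 4) \<le> sqrt ((1 - u) ^ n)" by (rule real_sqrt_le_mono)
  then have le: "1 / 2 \<le> sqrt (1 - u) ^ n" by (simp add: real_sqrt_power real_sqrt_divide)
  then have "1 / sqrt (1 - u) ^ n \<le> 1 / (1 / 2)" by (intro divide_left_mono) auto
  then show ?thesis by (simp add: power_one_over)
qed

text \<open>
  By independence the second moment for \<open>n\<close> observations is the \<open>n\<close>-th power of the one for a single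
  observation, and it stays below \<open>2\<close> by Bernoulli's inequality.
\<close>

lemma affinity_sign_flip:
  assumes p: "p \<ge> 1" and d: "\<And>i. i < p \<Longrightarrow> d i > 0" and m: "m \<in> {1..<p}"
    and \<beta>': "\<beta>' m = - \<beta> m" "\<And>i. i \<noteq> m \<Longrightarrow> \<beta>' i = \<beta> i"
    and small: "8 * (\<beta> m)\<^sup>2 * d m / d 0 < 1" "real n * (8 * (\<beta> m)\<^sup>2 * d m / d 0) \<le> 3 / 4"
  defines "S \<equiv> regression_cov p \<beta> d" and "S' \<equiv> regression_cov p \<beta>' d"
  shows "ennreal (1 / 2) \<le> (\<integral>\<^sup>+ X. ennreal (min (likelihood n p X S) (likelihood n p X S')) \<partial>lebesgue_sample n p)"
proof -
  have S: "S \<in> pos_def_mats p" "S' \<in> pos_def_mats p"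
    unfolding S_def S'_def by (rule regression_cov_pos_def[OF p d]; assumption)+
  let ?u = "8 * (\<beta> m)\<^sup>2 * d m / d 0"
  have u: "?u \<ge> 0" using d[of 0] d[of m] p m by (simp add: less_imp_le)
  have mvn: "mvn_density p S x = regression_density p \<beta> d x" "mvn_density p S' x = regression_density p \<beta>' d x" for x
    unfolding S_def S'_def by (rule mvn_density_regression_cov[OF p d]; assumption)+
  have one: "(\<integral>\<^sup>+ x. ennreal (regression_density p \<beta>' d x * regression_density p \<beta>' d x / regression_density p \<beta> d x)
      \<partial>lebesgue_vec p) = ennreal (1 / sqrt (1 - ?u))"
    by (rule chi_square_sign_flip[where m = m]) (use p d m \<beta>' small(1) in auto)
  have "(\<integral>\<^sup>+ X. ennreal ((likelihood n p X S')\<^sup>2 / likelihood n p X S) \<partial>lebesgue_sample n p) =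
    ennreal (1 / sqrt (1 - ?u)) ^ n"
    unfolding power2_eq_square nn_integral_likelihood_ratio[OF S(2,2,1)] mvn one ..
  also have "\<dots> = ennreal ((1 / sqrt (1 - ?u)) ^ n)" using small by (intro ennreal_power) simp
  also have "\<dots> \<le> ennreal 2" by (intro ennreal_leI inverse_sqrt_power_le_2 u small)
  finally show ?thesis
    using S by (intro affinity_ge_half) (auto simp: likelihood_pos less_imp_le nn_integral_likelihood)
qed

text \<open>
  Assouad's argument. The hypotheses are indexed by the set \<open>\<theta>\<close> of the positions in \<open>{1..<k}\<close> that carry
  a positive sign, and they all have the same weight. For every position \<open>j\<close> the hypotheses are
  grouped into the pairs \<open>\<theta>\<close>, \<open>insert j \<theta>\<close>; no value \<open>A $$ (0, j)\<close> is close to both \<open>a\<tau>\<close> and \<open>-a\<tau>\<close>, and the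
  distributions of the sample overlap by at least one half.
\<close>

lemma sup_risk_ge_bandwidth:
  fixes M0 M1 :: real
  assumes M: "0 < M1" "M1 < M0" and n: "1 \<le> n" and k: "1 \<le> k" "k \<le> p" and nk: "2 * real k \<le> real n"
    and proc: "(\<pi>, f) \<in> pp_procedures p"
  shows "ennreal (((M0 - M1) / 2)\<^sup>2 * (real k - 1) / (50 * real n)) \<le> (SUP S0 \<in> banded_cov p k M0 M1. pp_risk n p \<pi> f S0)"
proof -
  define e where "e = (M0 - M1) / 2"
  define a where "a = (M0 + M1) / 2"
  have ea: "0 < e" "e < a" "a - e = M1" "a + e = M0" using M by (auto simp: e_def a_def field_simps)
  then have a: "a > 0" by simp
  have p: "p \<ge> 1" using k by simp
  define J where "J = {1..<k}"
  define K where "K = real (card J)"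
  have J: "finite J" "J \<subseteq> {1..<p}" "J \<subseteq> {..<p}" "0 \<notin> J" using k by (auto simp: J_def)
  have K: "K = real k - 1" using k by (simp add: K_def J_def of_nat_diff)
  \<comment> \<open>The factor \<open>5\<close> keeps \<open>n \<tau>\<^sup>2 \<le> 1/25\<close>, so that the sign of one entry is undetectable.\<close>
  define \<tau> where "\<tau> = e / (5 * a * sqrt (real n))"
  have tau: "\<tau> > 0" using ea n by (simp add: \<tau>_def)
  have tau2: "real n * \<tau>\<^sup>2 = (e / a)\<^sup>2 / 25" using n by (simp add: \<tau>_def power_divide power_mult_distrib)
  have "(e / a)\<^sup>2 \<le> 1" using ea by (simp add: power_le_one)
  then have ntau: "real n * \<tau>\<^sup>2 \<le> 1 / 25" using tau2 by simp
  have Ktau: "K * \<tau>\<^sup>2 \<le> 1 / 50"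
  proof -
    have "2 * K \<le> real n" using nk K by simp
    then have "2 * K * \<tau>\<^sup>2 \<le> real n * \<tau>\<^sup>2" by (intro mult_right_mono) auto
    then show ?thesis using ntau by simp
  qed
  define \<beta> where "\<beta> \<theta> i = (if i \<in> J then if i \<in> \<theta> then \<tau> else - \<tau> else 0)" for \<theta> i
  \<comment> \<open>The residual variance is lowered so that all diagonal entries of \<open>S \<theta>\<close> are equal to \<open>a\<close>.\<close>
  define d where "d i = (if i = 0 then a * (1 - K * \<tau>\<^sup>2) else a)" for i :: nat
  define S where "S \<theta> = regression_cov p (\<beta> \<theta>) d" for \<theta>
  have d: "d i > 0" for i using a Ktau by (simp add: d_def)
  have beta2: "(\<beta> \<theta> i)\<^sup>2 = (if i \<in> J then \<tau>\<^sup>2 else 0)" for \<theta> i by (simp add: \<beta>_def)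
  have sum_beta: "(\<Sum>i\<in>{1..<p}. (\<beta> \<theta> i)\<^sup>2) = K * \<tau>\<^sup>2" for \<theta>
    using J by (simp add: beta2 K_def sum.If_cases Int_absorb1)
  have row0: "S \<theta> $$ (0, j) = a * \<beta> \<theta> j" if "j \<in> J" for \<theta> j
    using that J p by (auto simp: S_def regression_cov_def d_def)
  have band: "S \<theta> \<in> banded_cov p k M0 M1" for \<theta>
  proof (rule banded_covI[OF p])
    show "S \<theta> \<in> carrier_mat p p" by (simp add: S_def)
    show "0 < M1" by fact
    show "S \<theta> $$ (i, j) = S \<theta> $$ (j, i)" if "i < p" "j < p" for i j
      using that by (simp add: S_def regression_cov_sym)
    show "S \<theta> $$ (i, j) = 0" if "i < p" "j < p" "\<bar>int i - int j\<bar> > int k" for i j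
      using that by (auto simp: S_def regression_cov_def \<beta>_def J_def)
    have quad: "quad_form p (S \<theta>) x = a * (\<Sum>i<p. (x i)\<^sup>2) + 2 * a * x 0 * (\<Sum>i\<in>J. \<beta> \<theta> i * x i)" for x
    proof -
      have "quad_form p (S \<theta>) x = d 0 * (x 0)\<^sup>2 + (\<Sum>i\<in>{1..<p}. a * (x i + \<beta> \<theta> i * x 0)\<^sup>2)"
        unfolding S_def quad_form_regression_cov[OF p]
        by (intro arg_cong2[of _ _ _ _ "(+)"] sum.cong) (auto simp: d_def)
      also have "(\<Sum>i\<in>{1..<p}. a * (x i + \<beta> \<theta> i * x 0)\<^sup>2) =
          a * (\<Sum>i\<in>{1..<p}. (x i)\<^sup>2) + 2 * a * x 0 * (\<Sum>i\<in>{1..<p}. \<beta> \<theta> i * x i) + a * (x 0)\<^sup>2 * (\<Sum>i\<in>{1..<p}. (\<beta> \<theta> i)\<^sup>2)"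
      proof -
        have "(\<Sum>i\<in>{1..<p}. a * (x i + \<beta> \<theta> i * x 0)\<^sup>2) =
          (\<Sum>i\<in>{1..<p}. a * (x i)\<^sup>2 + 2 * a * x 0 * (\<beta> \<theta> i * x i) + a * (x 0)\<^sup>2 * (\<beta> \<theta> i)\<^sup>2)"
          by (intro sum.cong refl) (simp add: power2_eq_square algebra_simps)
        then show ?thesis by (simp only: sum.distrib sum_distrib_left)
      qed
      also have "(\<Sum>i\<in>{1..<p}. \<beta> \<theta> i * x i) = (\<Sum>i\<in>J. \<beta> \<theta> i * x i)"
        using J by (intro sum.mono_neutral_right) (auto simp: \<beta>_def)
      finally show ?thesis
        unfolding sum_beta by (simp add: lessThan_insert_0[OF p] d_def algebra_simps)
    qed
    have cross: "\<bar>2 * a * x 0 * (\<Sum>i\<in>J. \<beta> \<theta> i * x i)\<bar> \<le> e * (\<Sum>i<p. (x i)\<^sup>2)" for x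
    proof (cases "J = {}")
      case True
      then show ?thesis using ea by (simp add: sum_nonneg)
    next
      case False
      define s where "s = sqrt K"
      have "K > 0" using False J by (simp add: K_def card_gt_0_iff)
      then have s: "s > 0" "s * s = K" by (auto simp: s_def)
      \<comment> \<open>Weighting by \<open>s = sqrt K\<close> balances the \<open>K\<close> copies of \<open>(x 0)\<^sup>2\<close> against one copy of each \<open>(x i)\<^sup>2\<close>.\<close>
      have amgm: "\<bar>2 * x 0 * (\<beta> \<theta> i * x i)\<bar> \<le> \<tau> * (s * (x i)\<^sup>2 + (x 0)\<^sup>2 / s)" if "i \<in> J" for i
      proof -
        have "0 \<le> (s * \<bar>x i\<bar> - \<bar>x 0\<bar>)\<^sup>2 / s" using s by simp
        also have "\<dots> = s * (x i)\<^sup>2 + (x 0)\<^sup>2 / s - 2 * \<bar>x 0\<bar> * \<bar>x i\<bar>"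
          using s(1) by (simp add: power2_diff power_mult_distrib field_simps power2_eq_square)
        finally have "2 * \<bar>x 0\<bar> * \<bar>x i\<bar> \<le> s * (x i)\<^sup>2 + (x 0)\<^sup>2 / s" by simp
        then have "\<tau> * (2 * \<bar>x 0\<bar> * \<bar>x i\<bar>) \<le> \<tau> * (s * (x i)\<^sup>2 + (x 0)\<^sup>2 / s)"
          using tau by (intro mult_left_mono) auto
        moreover have "\<bar>2 * x 0 * (\<beta> \<theta> i * x i)\<bar> = \<tau> * (2 * \<bar>x 0\<bar> * \<bar>x i\<bar>)"
          using that tau by (simp add: \<beta>_def abs_mult)
        ultimately show ?thesis by simp
      qed
      have "\<bar>2 * a * x 0 * (\<Sum>i\<in>J. \<beta> \<theta> i * x i)\<bar> = a * \<bar>\<Sum>i\<in>J. 2 * x 0 * (\<beta> \<theta> i * x i)\<bar>"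
        using a by (simp add: abs_mult sum_distrib_left[symmetric])
      also have "\<dots> \<le> a * (\<Sum>i\<in>J. \<bar>2 * x 0 * (\<beta> \<theta> i * x i)\<bar>)"
        using a by (intro mult_left_mono sum_abs) auto
      also have "\<dots> \<le> a * (\<Sum>i\<in>J. \<tau> * (s * (x i)\<^sup>2 + (x 0)\<^sup>2 / s))"
        using a by (intro mult_left_mono sum_mono amgm) auto
      also have "(\<Sum>i\<in>J. \<tau> * (s * (x i)\<^sup>2 + (x 0)\<^sup>2 / s)) = \<tau> * (s * (\<Sum>i\<in>J. (x i)\<^sup>2) + K * ((x 0)\<^sup>2 / s))"
        by (simp add: sum_distrib_left[symmetric] sum.distrib K_def)
      also have "K * ((x 0)\<^sup>2 / s) = s * (x 0)\<^sup>2" using s by (simp add: s(2)[symmetric])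
      also have "a * (\<tau> * (s * (\<Sum>i\<in>J. (x i)\<^sup>2) + s * (x 0)\<^sup>2)) = (a * \<tau> * s) * ((\<Sum>i\<in>J. (x i)\<^sup>2) + (x 0)\<^sup>2)"
        by (simp add: algebra_simps)
      also have "\<dots> \<le> e * (\<Sum>i<p. (x i)\<^sup>2)"
      proof (intro mult_mono)
        have "s \<le> sqrt (real n)" unfolding s_def using K nk by simp
        then have "e * s \<le> 5 * (e * sqrt (real n))" using ea s by (simp add: mult_left_mono)
        then show "a * \<tau> * s \<le> e" using a n by (simp add: \<tau>_def field_simps)
        have "(\<Sum>i\<in>J. (x i)\<^sup>2) \<le> (\<Sum>i\<in>{1..<p}. (x i)\<^sup>2)" using J by (intro sum_mono2) auto
        then show "(\<Sum>i\<in>J. (x i)\<^sup>2) + (x 0)\<^sup>2 \<le> (\<Sum>i<p. (x i)\<^sup>2)" by (simp add: lessThan_insert_0[OF p])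
      qed (use ea in \<open>auto intro!: add_nonneg_nonneg sum_nonneg\<close>)
      finally show ?thesis .
    qed
    show "M1 * (\<Sum>i<p. (x i)\<^sup>2) \<le> quad_form p (S \<theta>) x" for x
      using cross[of x] unfolding quad ea(3)[symmetric] by (simp add: algebra_simps)
    show "quad_form p (S \<theta>) x \<le> M0 * (\<Sum>i<p. (x i)\<^sup>2)" for x
      using cross[of x] unfolding quad ea(4)[symmetric] by (simp add: algebra_simps)
  qed
  have pd: "S \<theta> \<in> pos_def_mats p" for \<theta> using band by (simp add: banded_cov_def)
  define g where "g \<theta> A = (\<Sum>j\<in>J. (A $$ (0, j) - a * \<beta> \<theta> j)\<^sup>2)" for \<theta> and A :: "real mat"
  define w :: "nat set \<Rightarrow> real" where "w \<theta> = 1 / 2 ^ card J" for \<theta>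
  define L where "L X \<theta> = likelihood n p X (S \<theta>)" for X \<theta>
  have L: "L X \<theta> > 0" for X \<theta> using pd by (simp add: L_def likelihood_pos)
  have [measurable]: "(\<lambda>X. L X \<theta>) \<in> borel_measurable (lebesgue_sample n p)" for \<theta>
    unfolding L_def using pd by simp
  define m where "m X = (\<Sum>i\<in>J. \<Sum>\<theta>\<in>Pow (J - {i}). (2 * (a * \<tau>)\<^sup>2 / 2 ^ card J) * min (L X \<theta>) (L X (insert i \<theta>)))" for X
  have m_meas: "m \<in> borel_measurable (lebesgue_sample n p)" unfolding m_def by measurable
  have m_le: "m X \<le> (\<Sum>\<theta>\<in>Pow J. w \<theta> * L X \<theta> * g \<theta> A)" for X A
  proof -
    have "(\<Sum>\<theta>\<in>Pow J. w \<theta> * L X \<theta> * g \<theta> A) =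
        (\<Sum>j\<in>J. \<Sum>\<theta>\<in>Pow J. w \<theta> * L X \<theta> * (A $$ (0, j) - a * \<beta> \<theta> j)\<^sup>2)"
      unfolding g_def sum_distrib_left by (rule sum.swap)
    also have "\<dots> = (\<Sum>j\<in>J. \<Sum>\<theta>\<in>Pow (J - {j}). w \<theta> * L X \<theta> * (A $$ (0, j) - a * \<beta> \<theta> j)\<^sup>2 +
       w (insert j \<theta>) * L X (insert j \<theta>) * (A $$ (0, j) - a * \<beta> (insert j \<theta>) j)\<^sup>2)"
      by (intro sum.cong refl sum_Pow_pair J)
    also have "\<dots> \<ge> m X"
      unfolding m_def
    proof (intro sum_mono)
      fix j \<theta> assume j: "j \<in> J" and \<theta>: "\<theta> \<in> Pow (J - {j})"
      define x where "x = A $$ (0, j)"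
      define l where "l = min (L X \<theta>) (L X (insert j \<theta>))"
      have b: "\<beta> \<theta> j = - \<tau>" "\<beta> (insert j \<theta>) j = \<tau>" using j \<theta> by (auto simp: \<beta>_def)
      have "l * (2 * (a * \<tau>)\<^sup>2) \<le> l * ((x + a * \<tau>)\<^sup>2 + (x - a * \<tau>)\<^sup>2)"
        using L[of X] by (intro mult_left_mono) (auto simp: l_def power2_eq_square algebra_simps less_imp_le)
      also have "\<dots> \<le> L X \<theta> * (x + a * \<tau>)\<^sup>2 + L X (insert j \<theta>) * (x - a * \<tau>)\<^sup>2"
        unfolding distrib_left by (intro add_mono mult_right_mono) (auto simp: l_def)
      finally have "l * (2 * (a * \<tau>)\<^sup>2) / 2 ^ card J \<le> (L X \<theta> * (x + a * \<tau>)\<^sup>2 + L X (insert j \<theta>) * (x - a * \<tau>)\<^sup>2) / 2 ^ card J"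
        by (rule divide_right_mono) simp
      then show "(2 * (a * \<tau>)\<^sup>2 / 2 ^ card J) * min (L X \<theta>) (L X (insert j \<theta>)) \<le>
        w \<theta> * L X \<theta> * (A $$ (0, j) - a * \<beta> \<theta> j)\<^sup>2 + w (insert j \<theta>) * L X (insert j \<theta>) * (A $$ (0, j) - a * \<beta> (insert j \<theta>) j)\<^sup>2"
        unfolding l_def[symmetric] x_def[symmetric] b by (simp add: w_def add_divide_distrib mult_ac)
    qed
    finally show ?thesis .
  qed
  have aff: "ennreal (1 / 2) \<le> (\<integral>\<^sup>+ X. ennreal (min (L X \<theta>) (L X (insert i \<theta>))) \<partial>lebesgue_sample n p)"
    if i: "i \<in> J" and \<theta>: "\<theta> \<in> Pow (J - {i})" for i \<theta>
    unfolding L_def S_def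
  proof (rule affinity_sign_flip[OF p d, where m = i])
    have sm: "8 * (\<beta> \<theta> i)\<^sup>2 * d i / d 0 \<le> 9 * \<tau>\<^sup>2"
    proof -
      have "8 * (\<beta> \<theta> i)\<^sup>2 * d i / d 0 = 8 * \<tau>\<^sup>2 / (1 - K * \<tau>\<^sup>2)"
        using i J(4) a by (auto simp: beta2 d_def)
      also have "\<dots> \<le> 8 * \<tau>\<^sup>2 / (8 / 9)" using Ktau by (intro divide_left_mono) auto
      finally show ?thesis by simp
    qed
    have "1 * \<tau>\<^sup>2 \<le> real n * \<tau>\<^sup>2" using n by (intro mult_right_mono) auto
    then show "8 * (\<beta> \<theta> i)\<^sup>2 * d i / d 0 < 1" using sm ntau by simp
    have "real n * (8 * (\<beta> \<theta> i)\<^sup>2 * d i / d 0) \<le> real n * (9 * \<tau>\<^sup>2)" using sm by (intro mult_left_mono) auto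
    then show "real n * (8 * (\<beta> \<theta> i)\<^sup>2 * d i / d 0) \<le> 3 / 4" using ntau by simp
  qed (use i \<theta> J in \<open>auto simp: \<beta>_def\<close>)
  have "ennreal (((M0 - M1) / 2)\<^sup>2 * (real k - 1) / (50 * real n)) = ennreal (K * (a * \<tau>)\<^sup>2 / 2)"
  proof -
    have "(a * \<tau>)\<^sup>2 = e\<^sup>2 / (25 * real n)" using a n by (simp add: \<tau>_def power_divide power_mult_distrib)
    then show ?thesis by (simp add: K e_def[symmetric] mult.commute)
  qed
  also have "K * (a * \<tau>)\<^sup>2 / 2 = (\<Sum>i\<in>J. \<Sum>\<theta>\<in>Pow (J - {i}). (2 * (a * \<tau>)\<^sup>2 / 2 ^ card J) * (1 / 2))"
  proof -
    have "(\<Sum>\<theta>\<in>Pow (J - {i}). (2 * (a * \<tau>)\<^sup>2 / 2 ^ card J) * (1 / 2)) = (a * \<tau>)\<^sup>2 / 2" if i: "i \<in> J" for i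
    proof -
      obtain q where q: "card J = Suc q" using J i by (cases "card J") auto
      have "card (Pow (J - {i})) = 2 ^ q" using J i q by (simp add: card_Pow)
      then show ?thesis by (simp add: q)
    qed
    then have "(\<Sum>i\<in>J. \<Sum>\<theta>\<in>Pow (J - {i}). (2 * (a * \<tau>)\<^sup>2 / 2 ^ card J) * (1 / 2)) = (\<Sum>i\<in>J. (a * \<tau>)\<^sup>2 / 2)"
      by (intro sum.cong refl)
    then show ?thesis by (simp only: sum_constant K_def)
  qed
  also have "ennreal \<dots> = (\<Sum>i\<in>J. \<Sum>\<theta>\<in>Pow (J - {i}). ennreal (2 * (a * \<tau>)\<^sup>2 / 2 ^ card J) * ennreal (1 / 2))"
  proof -
    have e: "ennreal (2 * (a * \<tau>)\<^sup>2 / 2 ^ card J) * ennreal (1 / 2) = ennreal (2 * (a * \<tau>)\<^sup>2 / 2 ^ card J * (1 / 2))"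
      by (rule ennreal_mult[symmetric]) auto
    show ?thesis unfolding e by (simp add: sum_nonneg del: sum_constant)
  qed
  also have "\<dots> \<le> (\<Sum>i\<in>J. \<Sum>\<theta>\<in>Pow (J - {i}). ennreal (2 * (a * \<tau>)\<^sup>2 / 2 ^ card J) *
      (\<integral>\<^sup>+ X. ennreal (min (L X \<theta>) (L X (insert i \<theta>))) \<partial>lebesgue_sample n p))"
    by (intro sum_mono mult_left_mono aff) auto
  also have "\<dots> = (\<integral>\<^sup>+ X. ennreal (m X) \<partial>lebesgue_sample n p)"
  proof -
    have "ennreal (m X) = (\<Sum>i\<in>J. \<Sum>\<theta>\<in>Pow (J - {i}). ennreal (2 * (a * \<tau>)\<^sup>2 / 2 ^ card J) * ennreal (min (L X \<theta>) (L X (insert i \<theta>))))" for X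
      unfolding m_def using L[of X]
      by (simp add: ennreal_mult[symmetric] less_imp_le sum_nonneg)
    then show ?thesis by (simp add: nn_integral_sum nn_integral_cmult)
  qed
  also have "\<dots> \<le> (\<Sum>\<theta>\<in>Pow J. ennreal (w \<theta>) * pp_risk n p \<pi> f (S \<theta>))"
  proof (rule bayes_risk_ge[OF proc, where g = g])
    show "g \<theta> \<in> borel_measurable (mat_borel p)" for \<theta>
      unfolding g_def using J p by (intro borel_measurable_sum measurable_mat_entry_diff_square) auto
    show "g \<theta> A \<le> (spectral_norm (A - S \<theta>))\<^sup>2" if "A \<in> carrier_mat p p" for \<theta> A
    proof -
      have "g \<theta> A = (\<Sum>j\<in>J. (A $$ (0, j) - S \<theta> $$ (0, j))\<^sup>2)"
        unfolding g_def by (intro sum.cong) (auto simp: row0)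
      then show ?thesis
        using sub_row_le_spectral_norm[OF that pos_def_mats_carrier[OF pd] _ J(3), of 0] p by simp
    qed
    show "m X \<le> (\<Sum>\<theta>\<in>Pow J. w \<theta> * likelihood n p X (S \<theta>) * g \<theta> A)" for X A
      using m_le unfolding L_def .
  qed (use J pd m_meas in \<open>auto simp: w_def g_def sum_nonneg\<close>)
  finally show ?thesis
    using J band by (intro sup_risk_ge_average[OF proc, of "Pow J" S k M0 M1 w]) (auto simp: w_def card_Pow)
qed

text \<open>
  Le Cam's argument with a mixture. The index \<open>p\<close> stands for the hypothesis without bump, as no
  coordinate has that index; it has weight one half, and the bumps at \<open>0, \<dots>, p - 1\<close> share the other
  half. If \<open>A\<close> has all diagonal entries within \<open>a\<delta> / 2\<close> of \<open>a\<close>, then it is far from every bumped matrix;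
  otherwise it is far from the one without bump.
\<close>

lemma sup_risk_ge_variance_bump:
  fixes M0 M1 :: real
  assumes M: "0 < M1" "M1 \<le> a" "a * (1 + \<delta>) \<le> M0" and p: "1 \<le> p"
    and \<delta>: "0 < \<delta>" "\<delta> < 1" "(1 / sqrt (1 - \<delta>\<^sup>2)) ^ n \<le> real p + 1"
    and proc: "(\<pi>, f) \<in> pp_procedures p"
  shows "ennreal ((a * \<delta>)\<^sup>2 / 16) \<le> (SUP S0 \<in> banded_cov p k M0 M1. pp_risk n p \<pi> f S0)"
proof -
  have a: "a > 0" using M by simp
  define D where "D j i = (if i = j then a * (1 + \<delta>) else a)" for j i :: nat
  have D: "a \<le> D j i" "D j i \<le> a * (1 + \<delta>)" "0 < D j i" for j i using a \<delta> by (auto simp: D_def)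
  define S where "S j = regression_cov p (\<lambda>_. 0) (D j)" for j
  have diag: "S j $$ (i, i) = D j i" if "i < p" for i j using that by (simp add: S_def regression_cov_def)
  have band: "S j \<in> banded_cov p k M0 M1" for j
  proof (rule banded_covI[OF p])
    show "S j \<in> carrier_mat p p" by (simp add: S_def)
    show "0 < M1" by fact
    show "S j $$ (i, l) = S j $$ (l, i)" if "i < p" "l < p" for i l
      using that by (simp add: S_def regression_cov_sym)
    show "S j $$ (i, l) = 0" if "i < p" "l < p" "\<bar>int i - int l\<bar> > int k" for i l
      using that by (auto simp: S_def regression_cov_def)
    have quad: "quad_form p (S j) x = (\<Sum>i<p. D j i * (x i)\<^sup>2)" for x
      by (simp add: S_def quad_form_regression_cov[OF p] lessThan_insert_0[OF p])
    show "M1 * (\<Sum>i<p. (x i)\<^sup>2) \<le> quad_form p (S j) x" for x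
      unfolding quad sum_distrib_left using M(2) order_trans[OF M(2) D(1)] by (intro sum_mono mult_right_mono) auto
    show "quad_form p (S j) x \<le> M0 * (\<Sum>i<p. (x i)\<^sup>2)" for x
      unfolding quad sum_distrib_left using order_trans[OF D(2) M(3)] by (intro sum_mono mult_right_mono) auto
  qed
  have pd: "S j \<in> pos_def_mats p" for j using band by (simp add: banded_cov_def)
  define L where "L X j = likelihood n p X (S j)" for X j
  have L: "L X j > 0" for X j using pd by (simp add: L_def likelihood_pos)
  have [measurable]: "(\<lambda>X. L X j) \<in> borel_measurable (lebesgue_sample n p)" for j
    unfolding L_def using pd by simp
  have intL: "(\<integral>\<^sup>+ X. ennreal (L X j) \<partial>lebesgue_sample n p) = 1" for j
    unfolding L_def using pd by (rule nn_integral_likelihood)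
  have mvn: "mvn_density p (S j) x = regression_density p (\<lambda>_. 0) (D j) x" for j x
    unfolding S_def using mvn_density_regression_cov[OF p] D(3) by blast
  have mvn_base: "mvn_density p (S p) x = regression_density p (\<lambda>_. 0) (\<lambda>_. a) x" for x
    unfolding mvn regression_density_diag[OF p] by (intro prod.cong) (auto simp: D_def)
  define Q where "Q X = (\<Sum>j<p. 1 / real p * L X j)" for X
  have Q: "Q X \<ge> 0" for X unfolding Q_def using L[of X] by (intro sum_nonneg) (simp add: less_imp_le)
  have [measurable]: "Q \<in> borel_measurable (lebesgue_sample n p)" unfolding Q_def by measurable
  have chi: "(\<integral>\<^sup>+ X. ennreal (L X j * L X l / L X p) \<partial>lebesgue_sample n p) \<le> ennreal (if j = l then real p + 1 else 1)"
    if "j < p" "l < p" for j l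
  proof -
    have "(\<integral>\<^sup>+ X. ennreal (L X j * L X l / L X p) \<partial>lebesgue_sample n p) =
      (if j = l then ennreal (1 / sqrt (1 - \<delta>\<^sup>2)) else 1) ^ n"
      unfolding L_def nn_integral_likelihood_ratio[OF pd pd pd] mvn_base unfolding mvn
      using chi_square_variance_bump[OF p a \<delta>(1,2) that] unfolding D_def by simp
    also have "\<dots> = (if j = l then ennreal ((1 / sqrt (1 - \<delta>\<^sup>2)) ^ n) else 1)"
      using \<delta> by (simp add: ennreal_power power_le_one)
    also have "\<dots> \<le> ennreal (if j = l then real p + 1 else 1)" using ennreal_leI[OF \<delta>(3)] by (auto simp del: ennreal_plus)
    finally show ?thesis .
  qed
  have aff: "ennreal (1 / 2) \<le> (\<integral>\<^sup>+ X. ennreal (min (L X p) (Q X)) \<partial>lebesgue_sample n p)"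
  proof (rule affinity_ge_half)
    have "ennreal (Q X) = (\<Sum>j<p. ennreal (1 / real p) * ennreal (L X j))" for X
      unfolding Q_def using L[of X] by (simp add: ennreal_mult[symmetric] less_imp_le sum_nonneg)
    then have "(\<integral>\<^sup>+ X. ennreal (Q X) \<partial>lebesgue_sample n p) = (\<Sum>j<p. ennreal (1 / real p))"
      by (simp add: nn_integral_sum nn_integral_cmult intL)
    also have "\<dots> = 1" using p by (simp add: ennreal_of_nat_eq_real_of_nat ennreal_mult[symmetric])
    finally show "(\<integral>\<^sup>+ X. ennreal (Q X) \<partial>lebesgue_sample n p) = 1" .
    have sq: "(Q X)\<^sup>2 / L X p = (\<Sum>j<p. \<Sum>l<p. (1 / (real p)\<^sup>2) * (L X j * L X l / L X p))" for X
      unfolding Q_def power2_eq_square sum_product sum_divide_distrib by (intro sum.cong refl) simp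
    have "ennreal ((Q X)\<^sup>2 / L X p) = (\<Sum>j<p. \<Sum>l<p. ennreal (1 / (real p)\<^sup>2) * ennreal (L X j * L X l / L X p))" for X
      unfolding sq using L[of X]
      by (simp add: ennreal_mult[symmetric] less_imp_le sum_nonneg)
    then have "(\<integral>\<^sup>+ X. ennreal ((Q X)\<^sup>2 / L X p) \<partial>lebesgue_sample n p) =
      (\<Sum>j<p. \<Sum>l<p. ennreal (1 / (real p)\<^sup>2) * (\<integral>\<^sup>+ X. ennreal (L X j * L X l / L X p) \<partial>lebesgue_sample n p))"
      by (simp add: nn_integral_sum nn_integral_cmult)
    also have "\<dots> \<le> (\<Sum>j<p. \<Sum>l<p. ennreal (1 / (real p)\<^sup>2) * ennreal (if j = l then real p + 1 else 1))"
      by (intro sum_mono mult_left_mono chi) auto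
    also have "\<dots> = ennreal (\<Sum>j<p. \<Sum>l<p. 1 / (real p)\<^sup>2 * (if j = l then real p + 1 else 1))"
      by (simp add: ennreal_mult[symmetric] sum_nonneg)
    also have "(\<Sum>j<p. \<Sum>l<p. 1 / (real p)\<^sup>2 * (if j = l then real p + 1 else 1)) = 2"
    proof -
      have "(\<Sum>l<p. 1 / (real p)\<^sup>2 * (if j = l then real p + 1 else 1)) = 2 / real p" if "j < p" for j
      proof -
        have "(\<Sum>l<p. 1 / (real p)\<^sup>2 * (if j = l then real p + 1 else 1)) =
          (\<Sum>l<p. 1 / (real p)\<^sup>2 * (1 + (if l = j then real p else 0)))"
          by (intro sum.cong) auto
        also have "\<dots> = 1 / (real p)\<^sup>2 * (real p + real p)"
        proof -
          have "(\<Sum>l<p. 1 + (if l = j then real p else 0)) = real p + real p"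
            using that by (simp add: sum.distrib)
          then show ?thesis by (simp only: sum_distrib_left[symmetric])
        qed
        finally show ?thesis using p by (simp add: power2_eq_square)
      qed
      then show ?thesis using p by simp
    qed
    finally show "(\<integral>\<^sup>+ X. ennreal ((Q X)\<^sup>2 / L X p) \<partial>lebesgue_sample n p) \<le> 2" by simp
  qed (use L Q in auto)
  define c where "c = (a * \<delta> / 2)\<^sup>2"
  define g where "g t A = (if t = p then Max ((\<lambda>j. (A $$ (j, j) - a)\<^sup>2) ` {..<p}) else (A $$ (t, t) - a * (1 + \<delta>))\<^sup>2)"
    for t and A :: "real mat"
  define w where "w t = (if t = p then 1 / 2 else 1 / (2 * real p))" for t
  have T: "{..p} = insert p {..<p}" by auto
  have ne: "{..<p} \<noteq> {}" using p by (metis lessThan_empty_iff not_one_le_zero)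
  have gp: "g p A \<ge> (A $$ (j, j) - a)\<^sup>2" if "j < p" for j A
    using that by (auto simp: g_def intro!: Max_ge)
  have le: "c / 2 * min (L X p) (Q X) \<le> (\<Sum>t\<in>{..p}. w t * likelihood n p X (S t) * g t A)" for X A
  proof -
    have g_nonneg: "g t A \<ge> 0" for t
      using order_trans[OF zero_le_power2 gp[of 0 A]] p by (cases "t = p") (auto simp: g_def)
    have sum: "(\<Sum>t\<in>{..p}. w t * likelihood n p X (S t) * g t A) =
       1 / 2 * L X p * g p A + (\<Sum>t<p. 1 / (2 * real p) * L X t * g t A)"
      unfolding T L_def by (simp add: w_def)
    have rest: "0 \<le> (\<Sum>t<p. 1 / (2 * real p) * L X t * g t A)"
      using L[of X] g_nonneg by (intro sum_nonneg) (simp add: less_imp_le)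
    have c: "c \<ge> 0" by (simp add: c_def)
    show ?thesis
    proof (cases "c \<le> g p A")
      case True
      have "c / 2 * min (L X p) (Q X) \<le> c / 2 * L X p" using c by (intro mult_left_mono) auto
      also have "\<dots> \<le> g p A / 2 * L X p" using True L[of X p] by (intro mult_right_mono) auto
      finally show ?thesis unfolding sum using rest by (simp add: mult_ac)
    next
      case False
      have "c \<le> g t A" if "t < p" for t
      proof -
        have "(A $$ (t, t) - a)\<^sup>2 < (a * \<delta> / 2)\<^sup>2" using gp[OF that, of A] False by (simp add: c_def)
        then have "\<bar>A $$ (t, t) - a\<bar> < a * \<delta> / 2"
          using a \<delta> by (metis abs_le_square_iff abs_of_pos linorder_not_le half_gt_zero mult_pos_pos)
        moreover have "0 < a * \<delta>" using a \<delta> by simp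
        moreover have "A $$ (t, t) - a * (1 + \<delta>) = (A $$ (t, t) - a) - a * \<delta>" by (simp add: algebra_simps)
        ultimately have "\<bar>a * \<delta> / 2\<bar> \<le> \<bar>A $$ (t, t) - a * (1 + \<delta>)\<bar>" by linarith
        then show ?thesis using that unfolding c_def g_def abs_le_square_iff by simp
      qed
      then have "(\<Sum>t<p. 1 / (2 * real p) * L X t * c) \<le> (\<Sum>t<p. 1 / (2 * real p) * L X t * g t A)"
        using L[of X] by (intro sum_mono mult_left_mono) (auto simp: less_imp_le)
      moreover have "(\<Sum>t<p. 1 / (2 * real p) * L X t * c) = c / 2 * Q X"
        unfolding Q_def sum_distrib_left by (intro sum.cong) auto
      moreover have "c / 2 * min (L X p) (Q X) \<le> c / 2 * Q X" using c by (intro mult_left_mono) auto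
      moreover have "0 \<le> 1 / 2 * L X p * g p A" using L[of X p] g_nonneg by simp
      ultimately show ?thesis unfolding sum by linarith
    qed
  qed
  have "ennreal ((a * \<delta>)\<^sup>2 / 16) = ennreal (c / 2) * ennreal (1 / 2)"
    by (subst ennreal_mult[symmetric]) (auto simp: c_def power_divide)
  also have "\<dots> \<le> ennreal (c / 2) * (\<integral>\<^sup>+ X. ennreal (min (L X p) (Q X)) \<partial>lebesgue_sample n p)"
    by (intro mult_left_mono aff) auto
  also have "\<dots> = (\<integral>\<^sup>+ X. ennreal (c / 2 * min (L X p) (Q X)) \<partial>lebesgue_sample n p)"
  proof -
    have "c / 2 \<ge> 0" by (simp add: c_def)
    then have "ennreal (c / 2 * min (L X p) (Q X)) = ennreal (c / 2) * ennreal (min (L X p) (Q X))" for X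
      using L[of X p] Q[of X] by (intro ennreal_mult) auto
    then show ?thesis by (simp only:) (rule nn_integral_cmult[symmetric], measurable)
  qed
  also have "\<dots> \<le> (\<Sum>t\<in>{..p}. ennreal (w t) * pp_risk n p \<pi> f (S t))"
  proof (rule bayes_risk_ge[OF proc, where g = g])
    show "g t \<in> borel_measurable (mat_borel p)" if "t \<in> {..p}" for t
    proof (cases "t = p")
      case True
      then show ?thesis unfolding g_def using True by (auto intro!: borel_measurable_Max measurable_mat_entry_diff_square)
    next
      case False
      then show ?thesis using that unfolding g_def by (auto intro!: measurable_mat_entry_diff_square)
    qed
    show "0 \<le> g t A" for t A
      using order_trans[OF zero_le_power2 gp[of 0 A]] p by (cases "t = p") (auto simp: g_def)
    have entry: "(A $$ (j, j) - S t $$ (j, j))\<^sup>2 \<le> (spectral_norm (A - S t))\<^sup>2" if "A \<in> carrier_mat p p" "j < p" for A j t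
      using sub_row_le_spectral_norm[OF that(1) pos_def_mats_carrier[OF pd] that(2), of "{j}"] that(2) by simp
    show "g t A \<le> (spectral_norm (A - S t))\<^sup>2" if t: "t \<in> {..p}" and A: "A \<in> carrier_mat p p" for t A
    proof (cases "t = p")
      case True
      have "(A $$ (j, j) - a)\<^sup>2 \<le> (spectral_norm (A - S t))\<^sup>2" if "j < p" for j
        using entry[OF A that, of t] True that by (simp add: diag D_def)
      then show ?thesis using ne True by (auto simp: g_def)
    next
      case False
      then have "t < p" using t by simp
      from entry[OF A this, of t] this show ?thesis by (simp add: diag D_def g_def)
    qed
    show "(\<lambda>X. c / 2 * min (L X p) (Q X)) \<in> borel_measurable (lebesgue_sample n p)" by measurable
  qed (use le pd in \<open>auto simp: w_def\<close>)
  finally show ?thesis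
    using band p by (intro sup_risk_ge_average[OF proc, of "{..p}" S k M0 M1 w]) (auto simp: w_def T)
qed

text \<open>
  The largest bump that is still undetectable has \<open>\<delta>\<^sup>2\<close> of order \<open>ln (p + 1) / n\<close>. The constant \<open>H\<close>
  scales it down so that the bumped variance does not exceed \<open>M0\<close>.
\<close>

lemma sup_risk_ge_log_dimension:
  fixes M0 M1 :: real
  assumes M: "0 < M1" "M1 < M0" and n: "1 \<le> n" and p: "1 \<le> p"
    and H: "ln (real p + 1) \<le> H * real n" "1 \<le> H"
    and proc: "(\<pi>, f) \<in> pp_procedures p"
  shows "ennreal (((M0 - M1) / 2)\<^sup>2 * ln (real p + 1) / (32 * H * real n)) \<le>
    (SUP S0 \<in> banded_cov p k M0 M1. pp_risk n p \<pi> f S0)"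
proof -
  define e where "e = (M0 - M1) / 2"
  define a where "a = (M0 + M1) / 2"
  have ea: "0 < e" "e < a" "a - e = M1" "a + e = M0" using M by (auto simp: e_def a_def field_simps)
  define l where "l = ln (real p + 1)"
  have l: "l > 0" using p by (simp add: l_def)
  define x where "x = (e / a)\<^sup>2 * l / (2 * H * real n)"
  have r: "0 < (e / a)\<^sup>2" "(e / a)\<^sup>2 < 1" using ea by (auto simp: power_less_one_iff)
  have Hn: "H * real n > 0" using H n by simp
  have x: "0 < x" using r l Hn by (simp add: x_def)
  have "l / (2 * H * real n) \<le> 1 / 2" using H(1) Hn by (simp add: l_def field_simps)
  then have "(e / a)\<^sup>2 * (l / (2 * H * real n)) \<le> (e / a)\<^sup>2 * (1 / 2)" using r by (intro mult_left_mono) auto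
  then have x_le: "x \<le> (e / a)\<^sup>2 / 2" by (simp add: x_def)
  then have x_half: "x \<le> 1 / 2" using r by simp
  define \<delta> where "\<delta> = sqrt x"
  have \<delta>: "\<delta> > 0" "\<delta>\<^sup>2 = x" using x by (auto simp: \<delta>_def)
  have "\<delta> \<le> e / a"
  proof (rule power2_le_imp_le)
    show "\<delta>\<^sup>2 \<le> (e / a)\<^sup>2" using x_le x \<delta> by simp
  qed (use ea in simp)
  then have ad: "a * \<delta> \<le> e" using ea by (simp add: field_simps)
  have "\<delta> < 1" using \<open>\<delta> \<le> e / a\<close> ea by (simp add: less_le_trans[of "e / a" 1] order_le_less_trans)
  have "real n * x \<le> l"
  proof -
    have "real n * x = (e / a)\<^sup>2 * l / (2 * H)" using n by (simp add: x_def)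
    also have "\<dots> \<le> 1 * l / 1" using r l H by (intro frac_le mult_right_mono) auto
    finally show ?thesis by simp
  qed
  \<comment> \<open>As \<open>1 - x \<ge> exp (-2x)\<close> for \<open>x \<le> 1/2\<close>, the left-hand side is at most \<open>exp (n x)\<close>.\<close>
  have "(1 / sqrt (1 - \<delta>\<^sup>2)) ^ n \<le> real p + 1"
  proof -
    have "x * x \<le> x * (1 / 2)" using x x_half by (intro mult_left_mono) auto
    then have "- 2 * x \<le> - x - 2 * x\<^sup>2" by (simp add: power2_eq_square)
    also have "\<dots> \<le> ln (1 - x)" using x x_half by (intro ln_one_minus_pos_lower_bound) auto
    finally have "- 2 * x \<le> ln (1 - x)" .
    then have "exp (- 2 * x) \<le> 1 - x" using x_half by (subst (asm) ln_ge_iff) auto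
    then have "sqrt (exp (- 2 * x)) \<le> sqrt (1 - x)" by (rule real_sqrt_le_mono)
    moreover have "sqrt (exp (- 2 * x)) = exp (- x)" by (rule real_sqrt_unique) (simp_all add: power2_eq_square exp_add[symmetric])
    ultimately have "exp (- x) \<le> sqrt (1 - x)" by (simp only:)
    then have "1 / sqrt (1 - x) \<le> 1 / exp (- x)" using x_half by (intro divide_left_mono) auto
    then have "1 / sqrt (1 - x) \<le> exp x" by (simp add: exp_minus field_simps)
    then have "(1 / sqrt (1 - x)) ^ n \<le> exp x ^ n" using x_half by (intro power_mono) auto
    also have "\<dots> = exp (real n * x)" by (simp add: exp_of_nat_mult)
    also have "\<dots> \<le> exp l" using \<open>real n * x \<le> l\<close> by simp
    also have "\<dots> = real p + 1" by (simp add: l_def)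
    finally show ?thesis by (simp add: \<delta>)
  qed
  then have "ennreal ((a * \<delta>)\<^sup>2 / 16) \<le> (SUP S0 \<in> banded_cov p k M0 M1. pp_risk n p \<pi> f S0)"
    using M ea ad \<delta>(1) \<open>\<delta> < 1\<close> p proc by (intro sup_risk_ge_variance_bump) (auto simp: distrib_left)
  moreover have "(a * \<delta>)\<^sup>2 / 16 = ((M0 - M1) / 2)\<^sup>2 * ln (real p + 1) / (32 * H * real n)"
    using ea Hn unfolding power_mult_distrib \<delta> e_def[symmetric] l_def[symmetric] by (simp add: x_def power_divide)
  ultimately show ?thesis by simp
qed

theorem theorem3p2:
  fixes M0 M1 :: real
  assumes "0 < M1" and "M1 \<le> M0"
  shows "\<exists>C::real. 0 \<le> C \<and> (M1 < M0 \<longrightarrow> 0 < C) \<and>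
    (\<forall>n p k :: nat. 1 \<le> n \<longrightarrow> 1 \<le> p \<longrightarrow> k \<le> p \<longrightarrow>
      real n / 2 \<ge> max (min ((M0 - M1)\<^sup>2) 1 * ln (real p)) (real k) \<longrightarrow>
      (INF (\<pi>, f) \<in> pp_procedures p. SUP S0 \<in> banded_cov p k M0 M1. pp_risk n p \<pi> f S0)
        \<ge> ennreal (C * ((real k + ln (real p)) / real n)))"
proof (cases "M1 < M0")
  case False
  then show ?thesis by (intro exI[of _ 0]) auto
next
  case True
  define \<mu> where "\<mu> = min ((M0 - M1)\<^sup>2) 1"
  have \<mu>: "\<mu> > 0" using True by (simp add: \<mu>_def)
  \<comment> \<open>The hypothesis on \<open>n\<close> gives \<open>ln p \<le> n / (2 \<mu>)\<close>, and \<open>ln 2 \<le> 1 \<le> n\<close> accounts for \<open>p + 1\<close>.\<close>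
  define H where "H = 1 + 1 / (2 * \<mu>)"
  have H: "H \<ge> 1" using \<mu> by (simp add: H_def)
  define E where "E = ((M0 - M1) / 2)\<^sup>2"
  have E: "E > 0" using True by (simp add: E_def)
  define C where "C = E / (200 * H)"
  have C: "C > 0" using E H by (simp add: C_def)
  have "ennreal (C * ((real k + ln (real p)) / real n)) \<le> (SUP S0 \<in> banded_cov p k M0 M1. pp_risk n p \<pi> f S0)"
    if n: "1 \<le> n" and p: "1 \<le> p" and k: "k \<le> p" and bound: "max (\<mu> * ln (real p)) (real k) \<le> real n / 2"
      and proc: "(\<pi>, f) \<in> pp_procedures p" for n p k :: nat and \<pi> f
  proof -
    define l where "l = ln (real p + 1)"
    have "ln (2::real) \<le> l" using p by (simp add: l_def)
    then have l: "1 / 2 \<le> l" using ln2_ge_two_thirds by simp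
    have lnp: "ln (real p) \<le> l" using p by (simp add: l_def)
    have Hn: "l \<le> H * real n"
    proof -
      have "l \<le> ln (2 * real p)" using p by (simp add: l_def)
      also have "\<dots> = ln 2 + ln (real p)" using p by (simp add: ln_mult)
      also have "ln (real p) \<le> real n / (2 * \<mu>)" using bound \<mu> by (simp add: field_simps)
      also have "ln 2 \<le> (1::real)" using ln_le_minus_one[of "2::real"] by simp
      also have "1 + real n / (2 * \<mu>) \<le> H * real n" using n by (simp add: H_def algebra_simps)
      finally show ?thesis by simp
    qed
    \<comment> \<open>The larger of the two bounds is within a constant factor of \<open>(k + ln p) / n\<close>.\<close>
    show ?thesis
    proof (cases "real k - 1 \<le> 3 * l")
      case True
      have "C * ((real k + ln (real p)) / real n) \<le> C * (6 * l / real n)"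
        using True lnp l C n by (intro mult_left_mono divide_right_mono) auto
      also have "\<dots> \<le> E * l / (32 * H * real n)"
      proof -
        have "C * 6 \<le> E / (32 * H)" using E H by (simp add: C_def field_simps)
        then have "C * 6 * (l / real n) \<le> E / (32 * H) * (l / real n)" using l by (intro mult_right_mono) auto
        then show ?thesis by simp
      qed
      finally have "ennreal (C * ((real k + ln (real p)) / real n)) \<le> ennreal (E * l / (32 * H * real n))"
        by (rule ennreal_leI)
      also have "\<dots> \<le> (SUP S0 \<in> banded_cov p k M0 M1. pp_risk n p \<pi> f S0)"
        unfolding E_def l_def
        by (rule sup_risk_ge_log_dimension[OF assms(1) \<open>M1 < M0\<close> n p Hn[unfolded l_def] H proc])
      finally show ?thesis .
    next
      case False
      then have k1: "1 \<le> k" using l by (cases k) auto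
      have "C * ((real k + ln (real p)) / real n) \<le> C * (2 * (real k - 1) / real n)"
        using False lnp l C n by (intro mult_left_mono divide_right_mono) auto
      also have "\<dots> \<le> E * (real k - 1) / (50 * real n)"
      proof -
        have "C * 2 \<le> E / 50" using E H by (simp add: C_def field_simps)
        then have "C * 2 * ((real k - 1) / real n) \<le> E / 50 * ((real k - 1) / real n)"
          using k1 by (intro mult_right_mono) auto
        then show ?thesis by (simp only: times_divide_eq_right times_divide_times_eq mult.assoc)
      qed
      finally have "ennreal (C * ((real k + ln (real p)) / real n)) \<le> ennreal (E * (real k - 1) / (50 * real n))"
        by (rule ennreal_leI)
      also have "\<dots> \<le> (SUP S0 \<in> banded_cov p k M0 M1. pp_risk n p \<pi> f S0)"
        unfolding E_def using bound by (intro sup_risk_ge_bandwidth[OF assms(1) \<open>M1 < M0\<close> n k1 k _ proc]) simp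
      finally show ?thesis .
    qed
  qed
  then show ?thesis
    using C unfolding \<mu>_def by (intro exI[of _ C]) (auto intro!: INF_greatest)
qed

end
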